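(* Let $G$ be a compact group, let $W$ be a real Banach space, and let $\alpha$ be a strongly continuous representation of $G$ on $W$ by isometries. Let $V$ be a closed $\alpha$-invariant subspace of $W$. If a bounded linear projection from $W$ onto $V$ exists, then an $\alpha$-invariant bounded linear projection from $W$ onto $V$ exists (a projection $P$ being $\alpha$-invariant if $\alpha_g\circ P\circ\alpha_g^{-1}=P$ for all $g\in G$). This $\alpha$-invariant projection is unique if and only if $V$ is $\alpha$-full. If $V$ is $\alpha$-full, then this $\alpha$-invariant projection is a projection of minimal norm among all bounded linear projections from $W$ onto $V$.
   Context: Let $\tilde G$ be the set of equivalence classes of irreducible real representations of $G$ (all finite-dimensional). For $\gamma\in\tilde G$, the $\gamma$-isotypic component $W_\gamma$ of $W$ is the closed linear span of all finite-dimensional $\alpha$-invariant subspaces of $W$ on which $\alpha$ restricts to a representation equivalent to $\gamma$ (equivalently, the range of the projection $\alpha_{p_\gamma}$, the integrated form of the suitably normalized character $p_\gamma$ of $\gamma$). For an $\alpha$-invariant subspace $V$, its isotypic components are $V_\gamma=V\cap W_\gamma$. $V$ is called $\alpha$-full if $V_\gamma=W_\gamma$ for every $\gamma\in\tilde G$ with $V_\gamma\ne\{0\}$. *)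

theory Defs
  imports "HOL-Analysis.Analysis" "HOL-Algebra.Group"
begin

definition compact_group :: "('g, 'z) monoid_scheme \<Rightarrow> 'g topology \<Rightarrow> bool" where
  "compact_group G T \<longleftrightarrow> group G \<and> topspace T = carrier G \<and> compact_space T \<and>
     Hausdorff_space T \<and>
     continuous_map (prod_topology T T) T (\<lambda>(x, y). x \<otimes>\<^bsub>G\<^esub> y) \<and>
     continuous_map T T (\<lambda>x. inv\<^bsub>G\<^esub> x)"

definition strongly_cont_isometric_rep ::
  "('g, 'z) monoid_scheme \<Rightarrow> 'g topology \<Rightarrow> ('g \<Rightarrow> 'w::banach \<Rightarrow> 'w) \<Rightarrow> bool" where
  "strongly_cont_isometric_rep G T \<alpha> \<longleftrightarrow>
     (\<forall>g\<in>carrier G. bounded_linear (\<alpha> g) \<and> (\<forall>w. norm (\<alpha> g w) = norm w)) \<and>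
     \<alpha> \<one>\<^bsub>G\<^esub> = id \<and>
     (\<forall>g\<in>carrier G. \<forall>h\<in>carrier G. \<alpha> (g \<otimes>\<^bsub>G\<^esub> h) = \<alpha> g \<circ> \<alpha> h) \<and>
     (\<forall>w. continuous_map T euclidean (\<lambda>g. \<alpha> g w))"

definition rep_invariant :: "('g, 'z) monoid_scheme \<Rightarrow> ('g \<Rightarrow> 'w \<Rightarrow> 'w) \<Rightarrow> 'w set \<Rightarrow> bool" where
  "rep_invariant G \<alpha> U \<longleftrightarrow> (\<forall>g\<in>carrier G. \<alpha> g ` U \<subseteq> U)"

definition is_projection_onto :: "'w::real_normed_vector set \<Rightarrow> ('w \<Rightarrow> 'w) \<Rightarrow> bool" where
  "is_projection_onto V P \<longleftrightarrow> bounded_linear P \<and> range P = V \<and> (\<forall>v\<in>V. P v = v)"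

definition rep_invariant_map :: "('g, 'z) monoid_scheme \<Rightarrow> ('g \<Rightarrow> 'w \<Rightarrow> 'w) \<Rightarrow> ('w \<Rightarrow> 'w) \<Rightarrow> bool" where
  "rep_invariant_map G \<alpha> P \<longleftrightarrow> (\<forall>g\<in>carrier G. \<alpha> g \<circ> P \<circ> \<alpha> (inv\<^bsub>G\<^esub> g) = P)"

definition fin_inv_subspace :: "('g, 'z) monoid_scheme \<Rightarrow> ('g \<Rightarrow> 'w::real_vector \<Rightarrow> 'w) \<Rightarrow> 'w set \<Rightarrow> bool" where
  "fin_inv_subspace G \<alpha> U \<longleftrightarrow> subspace U \<and> (\<exists>B. finite B \<and> span B = U) \<and> rep_invariant G \<alpha> U"

definition irred_subspace :: "('g, 'z) monoid_scheme \<Rightarrow> ('g \<Rightarrow> 'w::real_vector \<Rightarrow> 'w) \<Rightarrow> 'w set \<Rightarrow> bool" where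
  "irred_subspace G \<alpha> U \<longleftrightarrow> fin_inv_subspace G \<alpha> U \<and> U \<noteq> {0} \<and>
     (\<forall>U'. subspace U' \<and> U' \<subseteq> U \<and> rep_invariant G \<alpha> U' \<longrightarrow> U' = {0} \<or> U' = U)"

definition equiv_subrep :: "('g, 'z) monoid_scheme \<Rightarrow> ('g \<Rightarrow> 'w::real_vector \<Rightarrow> 'w) \<Rightarrow> 'w set \<Rightarrow> 'w set \<Rightarrow> bool" where
  "equiv_subrep G \<alpha> U U' \<longleftrightarrow>
     (\<exists>S. linear S \<and> bij_betw S U U' \<and> (\<forall>g\<in>carrier G. \<forall>u\<in>U. S (\<alpha> g u) = \<alpha> g (S u)))"

text \<open>Isotypic component W_gamma of W, for the class gamma of the irreducible
  subrepresentation on U: closed linear span of all finite-dimensional invariant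
  subspaces on which alpha is equivalent to gamma.\<close>
definition isotypic_component :: "('g, 'z) monoid_scheme \<Rightarrow> ('g \<Rightarrow> 'w::real_normed_vector \<Rightarrow> 'w) \<Rightarrow> 'w set \<Rightarrow> 'w set" where
  "isotypic_component G \<alpha> U =
     closure (span (\<Union>{U'. fin_inv_subspace G \<alpha> U' \<and> equiv_subrep G \<alpha> U' U}))"

text \<open>V is alpha-full: V_gamma = W_gamma whenever V_gamma = V \<inter> W_gamma is nonzero.
  Classes gamma not occurring in W have W_gamma = {0} and impose no condition, so it
  suffices to range over classes realised by irreducible invariant subspaces U of W.\<close>
definition alpha_full :: "('g, 'z) monoid_scheme \<Rightarrow> ('g \<Rightarrow> 'w::real_normed_vector \<Rightarrow> 'w) \<Rightarrow> 'w set \<Rightarrow> bool" where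
  "alpha_full G \<alpha> V \<longleftrightarrow>
     (\<forall>U. irred_subspace G \<alpha> U \<longrightarrow>
        V \<inter> isotypic_component G \<alpha> U \<noteq> {0} \<longrightarrow>
        V \<inter> isotypic_component G \<alpha> U = isotypic_component G \<alpha> U)"

end

theory Submission
  imports Defs
begin

text \<open>
  Averaging \<open>\<alpha> g \<circ> Q \<circ> \<alpha> (inv g)\<close> over the group turns a projection \<open>Q\<close> onto \<open>V\<close> into an invariant one
  whose norm is not larger; this gives existence, and minimality once uniqueness is known.

  If \<open>V\<close> is full and \<open>D\<close> is the difference of two invariant projections, then \<open>D\<close> vanishes on \<open>V\<close> and
  maps an irreducible subspace \<open>U\<close> with \<open>D U \<noteq> 0\<close> onto an equivalent subspace of \<open>V\<close>, so that fullness
  forces \<open>U \<subseteq> V\<close>, a contradiction. Such a \<open>U\<close> exists if \<open>D \<noteq> 0\<close> by the Peter--Weyl theorem, applied to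
  a coefficient \<open>g \<mapsto> q (D (\<alpha> g w))\<close>. If \<open>V\<close> is not full and \<open>P\<close> is an invariant projection, then the
  kernel of \<open>P\<close> contains an irreducible \<open>U2\<close> equivalent to some \<open>U1 \<subseteq> V\<close>, and an invariant projection
  onto \<open>U2\<close> followed by the equivalence can be added to \<open>P\<close>.

  The mean of a continuous Banach-space-valued function is the constant uniformly approximated by
  averages of its left translates; no measure is involved. The eigenfunctions needed for Peter--Weyl
  are obtained as the uniform limit of the normalised iterates of a convolution operator, applied to its
  own kernel: these iterates do not tend to zero because the operator norm is bounded by the
  Hilbert--Schmidt norm.
\<close>

section \<open>Averages of translates\<close>

text \<open>Working over the reals shapes two choices. Intertwining maps enter only through the fact
  that one which is nonzero on an irreducible subspace is injective there, so the endomorphisms of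
  an irreducible representation never have to be determined. And a symmetric convolution operator
  may have its dominant eigenvalue of either sign, so eigenfunctions are taken for its square, where
  that eigenvalue is positive.

  Since W has no inner product, the question is moved to scalar functions on the group: a functional
  \<open>q\<close> turns \<open>D\<close> into a coefficient, Peter--Weyl is needed only as the
  existence of a finite-dimensional translation-invariant space of functions not orthogonal to it,
  and integrating the orbit of \<open>w\<close> against these functions carries that space back into
  W.

  The map \<open>S\<close> in \<open>equiv_subrep\<close> is linear on all of W but need not be
  bounded. It enters bounded operators only behind a finite-rank projection, which is why the
  projection lemmas also assert that \<open>S\<close> composed with the projection is
  bounded.\<close>

lemma uniform_in_compact_parameter:
  fixes h :: "'k \<times> 'x \<Rightarrow> 'b::metric_space"
  assumes K: "compact_space K" and h: "continuous_map (prod_topology K X) euclidean h"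
    and x0: "x0 \<in> topspace X" and e: "e > 0"
  obtains V where "openin X V" "x0 \<in> V"
    "\<And>k v. k \<in> topspace K \<Longrightarrow> v \<in> V \<Longrightarrow> dist (h (k, v)) (h (k, x0)) < e"
proof -
  let ?P = "prod_topology K X"
  have "continuous_map ?P ?P (\<lambda>p. (fst p, x0))"
    using x0 by (auto intro!: continuous_map_pairedI continuous_map_fst)
  from continuous_map_compose[OF this h] have h0: "continuous_map ?P euclidean (\<lambda>p. h (fst p, x0))"
    by (simp add: o_def)
  have "continuous_map ?P euclideanreal (\<lambda>p. dist (h p) (h (fst p, x0)))"
    using h h0 by (simp add: continuous_map_atin tendsto_dist)
  then have W: "openin ?P {p \<in> topspace ?P. dist (h p) (h (fst p, x0)) < e}" (is "openin _ ?W")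
    unfolding continuous_map_upper_lower_semicontinuous_lt by blast
  have "topspace K \<times> {x0} \<subseteq> ?W"
    using x0 e by auto
  then obtain U V where "topspace K \<subseteq> U" "openin X V" "x0 \<in> V" "U \<times> V \<subseteq> ?W"
    using tube_lemma_left[OF W K[unfolded compact_space_def] x0] by blast
  then show thesis
    using that[of V] by fastforce
qed

text \<open>Lists rather than sets, because composing two averages multiplies group elements, and
  products that coincide must be counted separately.\<close>

definition avg :: "'a list \<Rightarrow> ('a \<Rightarrow> 'b::real_vector) \<Rightarrow> 'b" where
  "avg xs u = (1 / real (length xs)) *\<^sub>R (\<Sum>a\<leftarrow>xs. u a)"

lemma avg_cong: "(\<And>a. a \<in> set xs \<Longrightarrow> u a = v a) \<Longrightarrow> avg xs u = avg xs v"
  unfolding avg_def by (metis map_cong)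

lemma avg_const: "xs \<noteq> [] \<Longrightarrow> avg xs (\<lambda>_. c) = c"
  by (simp add: avg_def sum_list_triv scaleR_conv_of_real[symmetric] flip: scaleR_scaleR)
     (simp add: sum_list_sum_nth scaleR_conv_of_real sum_constant_scaleR)

lemma avg_add: "avg xs (\<lambda>a. u a + v a) = avg xs u + avg xs v"
  by (simp add: avg_def sum_list_addf scaleR_add_right)

lemma avg_diff: "avg xs (\<lambda>a. u a - v a) = avg xs u - avg xs v"
  by (simp add: avg_def sum_list_subtractf scaleR_diff_right)

lemma linear_avg:
  assumes "linear L"
  shows "L (avg xs u) = avg xs (\<lambda>a. L (u a))"
proof -
  interpret linear L by fact
  have "L (\<Sum>a\<leftarrow>xs. u a) = (\<Sum>a\<leftarrow>xs. L (u a))"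
    by (induction xs) (auto simp: zero add)
  then show ?thesis by (simp add: avg_def scale)
qed

lemma avg_avg:
  fixes u :: "'a \<Rightarrow> 'b \<Rightarrow> 'c::real_vector"
  shows "avg xs (\<lambda>a. avg ys (\<lambda>b. u a b)) =
    (1 / (real (length xs) * real (length ys))) *\<^sub>R (\<Sum>a\<leftarrow>xs. \<Sum>b\<leftarrow>ys. u a b)"
proof -
  have "(\<Sum>a\<leftarrow>xs. c *\<^sub>R v a) = c *\<^sub>R (\<Sum>a\<leftarrow>xs. v a)" for c and v :: "'a \<Rightarrow> 'c::real_vector"
    by (induction xs) (auto simp: scaleR_add_right)
  then show ?thesis
    by (simp add: avg_def)
qed

lemma avg_swap: "avg xs (\<lambda>a. avg ys (\<lambda>b. u a b)) = avg ys (\<lambda>b. avg xs (\<lambda>a. u a b))"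
proof -
  have "(\<Sum>a\<leftarrow>xs. \<Sum>b\<leftarrow>ys. u a b) = (\<Sum>b\<leftarrow>ys. \<Sum>a\<leftarrow>xs. u a b)"
    by (induction xs) (auto simp: sum_list_addf)
  then show ?thesis
    by (simp add: avg_avg mult.commute)
qed

lemma avg_product:
  "avg xs (\<lambda>a. avg ys (\<lambda>b. u a b)) = avg (List.product xs ys) (\<lambda>(a, b). u a b)"
proof -
  have "(\<Sum>a\<leftarrow>xs. \<Sum>b\<leftarrow>ys. u a b) = (\<Sum>(a, b)\<leftarrow>List.product xs ys. u a b)"
    by (induction xs) (auto simp: o_def)
  then show ?thesis
    by (simp add: avg_avg) (simp add: avg_def)
qed

lemma avg_map: "avg (map f xs) u = avg xs (\<lambda>a. u (f a))"
  by (simp add: avg_def o_def)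

lemma norm_avg_le:
  fixes u :: "'a \<Rightarrow> 'b::real_normed_vector"
  assumes "xs \<noteq> []" "\<And>a. a \<in> set xs \<Longrightarrow> norm (u a) \<le> e"
  shows "norm (avg xs u) \<le> e"
proof -
  have "norm (\<Sum>a\<leftarrow>xs. u a) \<le> length xs * e"
    using assms(2)
    by (induction xs) (auto simp: algebra_simps intro: norm_triangle_le add_mono)
  then show ?thesis
    using assms(1) by (simp add: avg_def field_simps)
qed

lemma norm_avg_diff_le:
  fixes u :: "'a \<Rightarrow> 'b::real_normed_vector"
  assumes "xs \<noteq> []" "\<And>a. a \<in> set xs \<Longrightarrow> norm (u a - w) \<le> e"
  shows "norm (avg xs u - w) \<le> e"
  using norm_avg_le[OF assms(1), of "\<lambda>a. u a - w" e] assms by (simp add: avg_diff avg_const)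

lemma continuous_map_avg:
  fixes u :: "'x \<Rightarrow> 'a \<Rightarrow> 'b::real_normed_vector"
  assumes "\<And>a. a \<in> set xs \<Longrightarrow> continuous_map X euclidean (\<lambda>x. u x a)"
  shows "continuous_map X euclidean (\<lambda>x. avg xs (u x))"
proof -
  have "continuous_map X euclidean (\<lambda>x. \<Sum>a\<leftarrow>xs. u x a)"
    using assms by (induction xs) (auto intro!: continuous_map_add)
  then show ?thesis
    unfolding avg_def by (simp add: continuous_map_atin tendsto_scaleR)
qed


section \<open>Compact groups: finite nets and contraction of the oscillation\<close>

locale compact_topological_group = group G for G :: "('g, 'z) monoid_scheme" (structure) +
  fixes T :: "'g topology"
  assumes topspace_eq: "topspace T = carrier G"
    and compact: "compact_space T"
    and continuous_mult: "continuous_map (prod_topology T T) T (\<lambda>(x, y). x \<otimes> y)"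
    and continuous_inv: "continuous_map T T (\<lambda>x. inv x)"
begin

lemma continuous_mult':
  assumes "continuous_map X T f" "continuous_map X T g"
  shows "continuous_map X T (\<lambda>x. f x \<otimes> g x)"
  using continuous_map_compose[OF continuous_map_pairedI[OF assms] continuous_mult]
  by (simp add: o_def)

lemma continuous_inv':
  assumes "continuous_map X T f"
  shows "continuous_map X T (\<lambda>x. inv (f x))"
  using continuous_map_compose[OF assms continuous_inv] by (simp add: o_def)

lemma continuous_const: "a \<in> carrier G \<Longrightarrow> continuous_map X T (\<lambda>x. a)"
  by (simp add: topspace_eq)

lemma continuous_comp:
  assumes "continuous_map T Y f" "continuous_map X T g"
  shows "continuous_map X Y (\<lambda>x. f (g x))"
  using continuous_map_compose[OF assms(2,1)] by (simp add: o_def)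

text \<open>Right multiplication by elements of some neighbourhood V of the identity moves
  \<open>F\<close> by less than \<open>e\<close>, uniformly. The translates of V by group elements b
  cover the group; the net consists of the inverses of the b in a finite subcover, since x lies in
  the translate by b exactly if \<open>inv b \<otimes> x\<close> lies in V. The compact parameter is
  carried along for the later exchange of two means.\<close>

lemma finite_net:
  fixes F :: "'g \<Rightarrow> 'y \<Rightarrow> 'b::real_normed_vector"
  assumes Y: "compact_space Y" and F: "continuous_map (prod_topology T Y) euclidean (\<lambda>(x, t). F x t)"
    and e: "e > 0"
  obtains A where "finite A" "A \<noteq> {}" "A \<subseteq> carrier G"
    "\<And>x. x \<in> carrier G \<Longrightarrow>
      \<exists>i\<in>A. \<forall>a\<in>carrier G. \<forall>t\<in>topspace Y. norm (F (a \<otimes> (i \<otimes> x)) t - F a t) < e"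
proof -
  let ?K = "prod_topology T Y"
  have K: "compact_space ?K"
    using compact Y by (simp add: compact_space_prod_topology)
  have c: "continuous_map (prod_topology ?K T) ?K (\<lambda>p. (fst (fst p) \<otimes> snd p, snd (fst p)))"
    by (intro continuous_map_pairedI continuous_mult' continuous_map_snd
        continuous_map_compose[OF continuous_map_fst continuous_map_fst, unfolded o_def]
        continuous_map_compose[OF continuous_map_fst continuous_map_snd, unfolded o_def])
  from continuous_map_compose[OF c F]
  have c: "continuous_map (prod_topology ?K T) euclidean (\<lambda>p. F (fst (fst p) \<otimes> snd p) (snd (fst p)))"
    by (simp add: o_def)
  have one: "\<one> \<in> topspace T" by (simp add: topspace_eq)
  obtain V where V: "openin T V" "\<one> \<in> V"
    and Vd: "\<And>k v. k \<in> topspace ?K \<Longrightarrow> v \<in> V \<Longrightarrow> dist (F (fst k \<otimes> v) (snd k)) (F (fst k \<otimes> \<one>) (snd k)) < e"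
    using uniform_in_compact_parameter[OF K c one e] by auto
  define N where "N b = {x \<in> topspace T. inv b \<otimes> x \<in> V}" for b
  have "openin T (N b)" if b: "b \<in> carrier G" for b
  proof -
    have "continuous_map T T (\<lambda>x. inv b \<otimes> x)"
      using b by (intro continuous_mult' continuous_const continuous_map_id[unfolded id_def]) simp
    then show ?thesis
      unfolding N_def using V(1) by (rule openin_continuous_map_preimage)
  qed
  moreover have "b \<in> N b" if "b \<in> carrier G" for b
    using that V(2) by (simp add: N_def topspace_eq)
  ultimately obtain D where D: "finite D" "D \<subseteq> carrier G" "carrier G \<subseteq> \<Union> (N ` D)"
    using compact[unfolded compact_space_def, THEN compactinD, of "N ` carrier G"] topspace_eq
    by (smt (verit) UN_I finite_subset_image imageE subsetI)
  show thesis
  proof (rule that[of "m_inv G ` D"])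
    show "finite (m_inv G ` D)" "m_inv G ` D \<subseteq> carrier G" using D by auto
    show "m_inv G ` D \<noteq> {}" using D(3) one_closed by blast
    fix x assume x: "x \<in> carrier G"
    then obtain b where b: "b \<in> D" "x \<in> N b" using D(3) by blast
    then have "norm (F (a \<otimes> (inv b \<otimes> x)) t - F a t) < e" if "a \<in> carrier G" "t \<in> topspace Y" for a t
      using Vd[of "(a, t)" "inv b \<otimes> x"] that by (auto simp: N_def dist_norm topspace_eq)
    then show "\<exists>i\<in>m_inv G ` D. \<forall>a\<in>carrier G. \<forall>t\<in>topspace Y. norm (F (a \<otimes> (i \<otimes> x)) t - F a t) < e"
      using b(1) by auto
  qed
qed

lemma bounded_parameter:
  fixes F :: "'g \<Rightarrow> 'y \<Rightarrow> 'b::real_normed_vector"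
  assumes Y: "compact_space Y" and F: "continuous_map (prod_topology T Y) euclidean (\<lambda>(x, t). F x t)"
  obtains C where "C > 0" "\<And>x t. x \<in> carrier G \<Longrightarrow> t \<in> topspace Y \<Longrightarrow> norm (F x t) \<le> C"
proof -
  have "compactin (prod_topology T Y) (topspace (prod_topology T Y))"
    using compact Y compact_space_def compact_space_prod_topology by blast
  from image_compactin[OF this F] have "bounded ((\<lambda>(x, t). F x t) ` (topspace T \<times> topspace Y))"
    by (simp add: compact_imp_bounded)
  then obtain C where "C > 0" "\<forall>y\<in>(\<lambda>(x, t). F x t) ` (topspace T \<times> topspace Y). norm y \<le> C"
    unfolding bounded_pos by blast
  then show thesis
    using that[of C] by (force simp: topspace_eq)
qed

text \<open>If \<open>A\<close> is a finite net as in \<open>finite_net\<close>, two of the \<open>card A\<close> terms of the averages at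
  \<open>x\<close> and at \<open>y\<close> can be matched with a difference of at most \<open>2e\<close>; hence averaging over \<open>A\<close>
  contracts the oscillation by the factor \<open>1 - 1 / card A\<close>, up to the error \<open>2e / card A\<close>.\<close>
lemma oscillation_avg_step:
  fixes f :: "'g \<Rightarrow> 'b::real_normed_vector"
  assumes A: "finite A" "A \<subseteq> carrier G"
    and osc: "\<And>x y. x \<in> carrier G \<Longrightarrow> y \<in> carrier G \<Longrightarrow> norm (f x - f y) \<le> d"
    and x: "x \<in> carrier G" "i \<in> A" "norm (f (i \<otimes> x) - f \<one>) \<le> e"
    and y: "y \<in> carrier G" "j \<in> A" "norm (f (j \<otimes> y) - f \<one>) \<le> e"
  shows "norm ((\<Sum>a\<in>A. f (a \<otimes> x)) - (\<Sum>a\<in>A. f (a \<otimes> y))) \<le> (real (card A) - 1) * d + 2 * e"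
proof -
  obtain p where p: "bij_betw p (A - {i}) (A - {j})"
    using A x y finite_same_card_bij[of "A - {i}" "A - {j}"] by auto
  have "(\<Sum>a\<in>A - {j}. f (a \<otimes> y)) = (\<Sum>a\<in>A - {i}. f (p a \<otimes> y))"
    using sum.reindex_bij_betw[OF p, of "\<lambda>a. f (a \<otimes> y)"] by simp
  then have "(\<Sum>a\<in>A. f (a \<otimes> x)) - (\<Sum>a\<in>A. f (a \<otimes> y)) =
      (f (i \<otimes> x) - f \<one>) - (f (j \<otimes> y) - f \<one>) + (\<Sum>a\<in>A - {i}. f (a \<otimes> x) - f (p a \<otimes> y))"
    using A(1) x(2) y(2)
    by (simp add: sum.remove[of A i "\<lambda>a. f (a \<otimes> x)"] sum.remove[of A j "\<lambda>a. f (a \<otimes> y)"] sum_subtractf)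
  also have "norm \<dots> \<le> (e + e) + (\<Sum>a\<in>A - {i}. d)"
  proof (rule norm_triangle_le[OF add_mono])
    show "norm ((f (i \<otimes> x) - f \<one>) - (f (j \<otimes> y) - f \<one>)) \<le> e + e"
      by (rule norm_triangle_le_diff) (use x y in simp)
    show "norm (\<Sum>a\<in>A - {i}. f (a \<otimes> x) - f (p a \<otimes> y)) \<le> (\<Sum>a\<in>A - {i}. d)"
    proof (rule sum_norm_le)
      fix a assume a: "a \<in> A - {i}"
      then have "p a \<in> A" using bij_betwE[OF p] by blast
      then show "norm (f (a \<otimes> x) - f (p a \<otimes> y)) \<le> d"
        using a A x y by (intro osc) auto
    qed
  qed
  also have "\<dots> = (real (card A) - 1) * d + 2 * e"
    using card_Suc_Diff1[OF A(1) x(2), symmetric] by (simp add: algebra_simps)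
  finally show ?thesis .
qed

text \<open>Iterates \<open>oscillation_avg_step\<close> with one and the same net \<open>A\<close>,
  so that the ratio \<open>q\<close> of the geometric decrease does not change from stage to
  stage.\<close>

lemma avg_almost_constant:
  fixes F :: "'g \<Rightarrow> 'y \<Rightarrow> 'b::real_normed_vector"
  assumes Y: "compact_space Y" and F: "continuous_map (prod_topology T Y) euclidean (\<lambda>(x, t). F x t)"
    and e: "e > 0"
  obtains xs where "xs \<noteq> []" "set xs \<subseteq> carrier G"
    "\<And>x y t. x \<in> carrier G \<Longrightarrow> y \<in> carrier G \<Longrightarrow> t \<in> topspace Y \<Longrightarrow>
      norm (avg xs (\<lambda>a. F (a \<otimes> x) t) - avg xs (\<lambda>a. F (a \<otimes> y) t)) \<le> e"
proof -
  define e' where "e' = e / 3"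
  have e': "e' > 0" using e by (simp add: e'_def)
  obtain A where A: "finite A" "A \<noteq> {}" "A \<subseteq> carrier G"
    and net: "\<And>x. x \<in> carrier G \<Longrightarrow>
      \<exists>i\<in>A. \<forall>a\<in>carrier G. \<forall>t\<in>topspace Y. norm (F (a \<otimes> (i \<otimes> x)) t - F a t) < e'"
    using finite_net[OF Y F e'] by blast
  obtain C where C: "C > 0" "\<And>x t. x \<in> carrier G \<Longrightarrow> t \<in> topspace Y \<Longrightarrow> norm (F x t) \<le> C"
    using bounded_parameter[OF Y F] by blast
  define N where "N = real (card A)"
  have N: "N \<ge> 1" unfolding N_def using A by (simp add: Suc_leI card_gt_0_iff)
  define q where "q = 1 - 1 / N"
  have q: "0 \<le> q" "q < 1" using N by (auto simp: q_def)
  obtain as where as: "set as = A" "distinct as" using A finite_distinct_list by metis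
  have len: "real (length as) = N" by (metis N_def as distinct_card)
  \<comment> \<open>\<open>2 * C\<close> bounds the initial oscillation. The summand
    \<open>2 * e'\<close> is the fixed point of s -> q s + 2 e' / N, so the errors of all stages
    together never exceed it; the last third of \<open>e\<close> is left for the power of
    \<open>q\<close>.\<close>
  have "\<exists>xs. xs \<noteq> [] \<and> set xs \<subseteq> carrier G \<and> (\<forall>x\<in>carrier G. \<forall>y\<in>carrier G. \<forall>t\<in>topspace Y.
      norm (avg xs (\<lambda>a. F (a \<otimes> x) t) - avg xs (\<lambda>a. F (a \<otimes> y) t)) \<le> q ^ n * (2 * C) + 2 * e')" for n
  proof (induction n)
    case 0
    have "norm (F x t - F y t) \<le> 2 * C + 2 * e'" if "x \<in> carrier G" "y \<in> carrier G" "t \<in> topspace Y" for x y t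
      using norm_triangle_ineq4[of "F x t" "F y t"] C(2)[OF that(1,3)] C(2)[OF that(2,3)] e' by linarith
    then show ?case
      by (intro exI[of _ "[\<one>]"]) (auto simp: avg_def)
  next
    case (Suc n)
    then obtain xs where xs: "xs \<noteq> []" "set xs \<subseteq> carrier G"
      and osc: "\<And>x y t. x \<in> carrier G \<Longrightarrow> y \<in> carrier G \<Longrightarrow> t \<in> topspace Y \<Longrightarrow>
      norm (avg xs (\<lambda>a. F (a \<otimes> x) t) - avg xs (\<lambda>a. F (a \<otimes> y) t)) \<le> q ^ n * (2 * C) + 2 * e'"
      by blast
    define f where "f t x = avg xs (\<lambda>a. F (a \<otimes> x) t)" for t x
    \<comment> \<open>The net survives averaging because \<open>net\<close> controls all
      \<open>a\<close> at once, in particular those in \<open>xs\<close>.\<close>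
    have fnet: "\<exists>i\<in>A. norm (f t (i \<otimes> x) - f t \<one>) \<le> e'" if x: "x \<in> carrier G" and t: "t \<in> topspace Y" for x t
    proof -
      obtain i where i: "i \<in> A" "\<And>a. a \<in> carrier G \<Longrightarrow> norm (F (a \<otimes> (i \<otimes> x)) t - F a t) < e'"
        using net[OF x] t by blast
      have "norm (avg xs (\<lambda>a. F (a \<otimes> (i \<otimes> x)) t - F (a \<otimes> \<one>) t)) \<le> e'"
      proof (rule norm_avg_le[OF xs(1)])
        fix a assume "a \<in> set xs"
        then have "a \<in> carrier G" using xs by auto
        then show "norm (F (a \<otimes> (i \<otimes> x)) t - F (a \<otimes> \<one>) t) \<le> e'"
          using i(2)[of a] by simp
      qed
      then show ?thesis using i(1) by (auto simp: f_def avg_diff)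
    qed
    \<comment> \<open>Averaging the \<open>xs\<close>-average again over \<open>as\<close> evaluates
      \<open>F\<close> at \<open>a \<otimes> (b \<otimes> x)\<close>, so the older factor stands on
      the left.\<close>
    define ys where "ys = map (\<lambda>(b, a). a \<otimes> b) (List.product as xs)"
    have ys: "avg ys (\<lambda>a. F (a \<otimes> x) t) = (\<Sum>a\<in>A. f t (a \<otimes> x)) /\<^sub>R N" if x: "x \<in> carrier G" for x t
    proof -
      have "avg ys (\<lambda>a. F (a \<otimes> x) t) = avg as (\<lambda>b. avg xs (\<lambda>a. F (a \<otimes> b \<otimes> x) t))"
        unfolding ys_def avg_map avg_product by (simp add: case_prod_unfold)
      also have "\<dots> = avg as (\<lambda>b. f t (b \<otimes> x))"
        unfolding f_def
      proof (intro avg_cong)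
        fix b a assume "b \<in> set as" "a \<in> set xs"
        then have "a \<in> carrier G" "b \<in> carrier G" using as A xs by auto
        then show "F (a \<otimes> b \<otimes> x) t = F (a \<otimes> (b \<otimes> x)) t" using x by (simp add: m_assoc)
      qed
      also have "\<dots> = (\<Sum>a\<in>A. f t (a \<otimes> x)) /\<^sub>R N"
        using as by (simp add: avg_def len sum_list_distinct_conv_sum_set divide_inverse)
      finally show ?thesis .
    qed
    have "norm (avg ys (\<lambda>a. F (a \<otimes> x) t) - avg ys (\<lambda>a. F (a \<otimes> y) t)) \<le> q ^ Suc n * (2 * C) + 2 * e'"
      if x: "x \<in> carrier G" and y: "y \<in> carrier G" and t: "t \<in> topspace Y" for x y t
    proof -
      obtain i j where ij: "i \<in> A" "norm (f t (i \<otimes> x) - f t \<one>) \<le> e'"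
         "j \<in> A" "norm (f t (j \<otimes> y) - f t \<one>) \<le> e'"
        using fnet[OF x t] fnet[OF y t] by blast
      have "norm ((\<Sum>a\<in>A. f t (a \<otimes> x)) - (\<Sum>a\<in>A. f t (a \<otimes> y))) \<le> (N - 1) * (q ^ n * (2 * C) + 2 * e') + 2 * e'"
        unfolding N_def using osc t
        by (intro oscillation_avg_step[OF A(1,3) _ x ij(1,2) y ij(3,4)]) (auto simp: f_def)
      then have "norm (avg ys (\<lambda>a. F (a \<otimes> x) t) - avg ys (\<lambda>a. F (a \<otimes> y) t)) \<le>
          ((N - 1) * (q ^ n * (2 * C) + 2 * e') + 2 * e') / N"
        using N by (simp add: ys x y scaleR_diff_right[symmetric] divide_simps mult.commute)
      also have "\<dots> = q ^ Suc n * (2 * C) + 2 * e'"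
        using N by (simp add: q_def divide_simps) (simp add: algebra_simps)
      finally show ?thesis .
    qed
    moreover have "ys \<noteq> []" 
      using xs(1) A as by (cases as; cases xs) (auto simp: ys_def)
    moreover have "set ys \<subseteq> carrier G"
      using xs(2) as A by (auto simp: ys_def)
    ultimately show ?case by blast
  qed
  note shrink = this
  obtain n where "q ^ n < e' / (2 * C)"
    using real_arch_pow_inv[of "e' / (2 * C)" q] q e' C by auto
  then have "q ^ n * (2 * C) + 2 * e' \<le> e"
    using C by (simp add: field_simps e'_def)
  moreover obtain xs where "xs \<noteq> []" "set xs \<subseteq> carrier G" "\<And>x y t. x \<in> carrier G \<Longrightarrow> y \<in> carrier G \<Longrightarrow> t \<in> topspace Y \<Longrightarrow>
      norm (avg xs (\<lambda>a. F (a \<otimes> x) t) - avg xs (\<lambda>a. F (a \<otimes> y) t)) \<le> q ^ n * (2 * C) + 2 * e'"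
    using shrink[of n] by blast
  ultimately show thesis
    by (intro that[of xs]) fastforce+
qed

end

section \<open>The invariant mean\<close>

lemma continuous_map_euclidean_dist:
  fixes f :: "'x \<Rightarrow> 'b::metric_space"
  shows "continuous_map X euclidean f \<longleftrightarrow>
    (\<forall>x\<in>topspace X. \<forall>e>0. \<exists>V. openin X V \<and> x \<in> V \<and> (\<forall>y\<in>V. dist (f y) (f x) < e))"
proof -
  have "(f \<longlongrightarrow> f x) (atin X x) \<longleftrightarrow> (\<forall>e>0. \<exists>V. openin X V \<and> x \<in> V \<and> (\<forall>y\<in>V. dist (f y) (f x) < e))"
    if x: "x \<in> topspace X" for x
  proof -
    have "(\<forall>y\<in>V - {x}. dist (f y) (f x) < e) \<longleftrightarrow> (\<forall>y\<in>V. dist (f y) (f x) < e)" if "e > 0" for V e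
      using that by (metis DiffI dist_self insertE insert_Diff_single singletonD DiffD1)
    then show ?thesis
      using x by (simp add: tendsto_iff eventually_atin)
  qed
  then show ?thesis by (simp add: continuous_map_atin)
qed

context compact_topological_group
begin

abbreviation cont :: "('g \<Rightarrow> 'b::real_normed_vector) \<Rightarrow> bool" where
  "cont f \<equiv> continuous_map T euclidean f"

definition approx_mean :: "('g \<Rightarrow> 'b::real_normed_vector) \<Rightarrow> 'b \<Rightarrow> real \<Rightarrow> bool" where
  "approx_mean f w e \<longleftrightarrow> (\<exists>xs. xs \<noteq> [] \<and> set xs \<subseteq> carrier G \<and>
     (\<forall>x\<in>carrier G. norm (avg xs (\<lambda>a. f (a \<otimes> x)) - w) \<le> e))"

text \<open>For continuous \<open>f\<close> with values in a Banach space this is the integral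
  against normalised Haar measure; \<open>ex_mean\<close> and \<open>mean_eqI\<close> justify the
  description.\<close>

definition mean :: "('g \<Rightarrow> 'b::real_normed_vector) \<Rightarrow> 'b" where
  "mean f = (THE w. \<forall>e>0. approx_mean f w e)"

lemma cont_inv: "cont f \<Longrightarrow> cont (\<lambda>x. f (inv x))"
  using continuous_comp[OF _ continuous_inv] .

lemma cont_left: "cont f \<Longrightarrow> k \<in> carrier G \<Longrightarrow> cont (\<lambda>x. f (k \<otimes> x))"
  by (rule continuous_comp, assumption)
     (intro continuous_mult' continuous_const continuous_map_id[unfolded id_def]; simp)

lemma cont_right: "cont f \<Longrightarrow> k \<in> carrier G \<Longrightarrow> cont (\<lambda>x. f (x \<otimes> k))"
  by (rule continuous_comp, assumption)
     (intro continuous_mult' continuous_const continuous_map_id[unfolded id_def]; simp)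

text \<open>The double average of \<open>f (a \<otimes> inv b)\<close> is close to both constants.\<close>
lemma approx_mean_close:
  assumes "approx_mean f w e" "approx_mean (\<lambda>x. f (inv x)) w' e'"
  shows "norm (w - w') \<le> e + e'"
proof -
  obtain xs where xs: "xs \<noteq> []" "set xs \<subseteq> carrier G"
    and w: "\<And>x. x \<in> carrier G \<Longrightarrow> norm (avg xs (\<lambda>a. f (a \<otimes> x)) - w) \<le> e"
    using assms(1) unfolding approx_mean_def by blast
  obtain ys where ys: "ys \<noteq> []" "set ys \<subseteq> carrier G"
    and w': "\<And>x. x \<in> carrier G \<Longrightarrow> norm (avg ys (\<lambda>b. f (inv (b \<otimes> x))) - w') \<le> e'"
    using assms(2) unfolding approx_mean_def by blast
  let ?D = "avg ys (\<lambda>b. avg xs (\<lambda>a. f (a \<otimes> inv b)))"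
  have 1: "norm (?D - w) \<le> e"
    using ys by (intro norm_avg_diff_le w) auto
  have "norm (avg xs (\<lambda>a. avg ys (\<lambda>b. f (a \<otimes> inv b))) - w') \<le> e'"
  proof (rule norm_avg_diff_le[OF xs(1)])
    fix a assume "a \<in> set xs"
    then have a: "a \<in> carrier G" using xs by auto
    have "avg ys (\<lambda>b. f (a \<otimes> inv b)) = avg ys (\<lambda>b. f (inv (b \<otimes> inv a)))"
      using a ys by (intro avg_cong) (auto simp: inv_mult_group subset_iff)
    then show "norm (avg ys (\<lambda>b. f (a \<otimes> inv b)) - w') \<le> e'"
      using w'[of "inv a"] a by simp
  qed
  then have 2: "norm (?D - w') \<le> e'"
    by (subst avg_swap)
  have "w - w' = (?D - w') - (?D - w)" by simp
  then have "norm (w - w') \<le> norm (?D - w') + norm (?D - w)"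
    by (metis norm_triangle_ineq4)
  with 1 2 show ?thesis by linarith
qed

lemma approx_mean_of_oscillation:
  assumes "xs \<noteq> []" "set xs \<subseteq> carrier G"
    "\<And>x y. x \<in> carrier G \<Longrightarrow> y \<in> carrier G \<Longrightarrow>
      norm (avg xs (\<lambda>a. f (a \<otimes> x)) - avg xs (\<lambda>a. f (a \<otimes> y))) \<le> e"
    and x: "x \<in> carrier G"
  shows "approx_mean f (avg xs (\<lambda>a. f (a \<otimes> x))) e"
  unfolding approx_mean_def using assms by blast

lemma approx_mean_exists:
  assumes f: "cont f" and e: "e > 0"
  obtains w where "approx_mean f w e"
proof -
  \<comment> \<open>A one-point parameter space specialises the uniform estimate to a single
    function.\<close>
  have "continuous_map (prod_topology T (discrete_topology {()})) euclidean (\<lambda>(x, t). f x)"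
    using continuous_comp[OF f continuous_map_fst] by (simp add: case_prod_unfold)
  from avg_almost_constant[OF _ this e] obtain xs where "xs \<noteq> []" "set xs \<subseteq> carrier G"
    "\<And>x y. x \<in> carrier G \<Longrightarrow> y \<in> carrier G \<Longrightarrow>
      norm (avg xs (\<lambda>a. f (a \<otimes> x)) - avg xs (\<lambda>a. f (a \<otimes> y))) \<le> e"
    by (auto simp: compact_space_discrete_topology)
  from that[OF approx_mean_of_oscillation[OF this one_closed]] show thesis .
qed

text \<open>Approximate means of \<open>f\<close> are close to each other because all of them are
  close to a single, arbitrarily accurate approximate mean of \<open>f\<close> composed with
  inversion. Completeness then supplies the limit.\<close>

lemma ex_mean:
  fixes f :: "'g \<Rightarrow> 'b::banach"
  assumes f: "cont f"
  shows "\<exists>w. \<forall>e>0. approx_mean f w e"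
proof -
  have "\<forall>n. \<exists>w. approx_mean f w (1 / Suc n)"
    using approx_mean_exists[OF f] by (metis of_nat_0_less_iff zero_less_Suc zero_less_divide_1_iff)
  then obtain w where w: "\<And>n. approx_mean f (w n) (1 / Suc n)" by metis
  have close: "norm (w n - w m) \<le> 1 / Suc n + 1 / Suc m" for n m
  proof (rule field_le_epsilon)
    fix e :: real assume "e > 0"
    then obtain v where v: "approx_mean (\<lambda>x. f (inv x)) v (e / 2)"
      using approx_mean_exists[OF cont_inv[OF f], of "e / 2"] by auto
    have "w n - w m = (w n - v) - (w m - v)" by simp
    then have "norm (w n - w m) \<le> norm (w n - v) + norm (w m - v)"
      by (metis norm_triangle_ineq4)
    then show "norm (w n - w m) \<le> 1 / Suc n + 1 / Suc m + e"
      using approx_mean_close[OF w[of n] v] approx_mean_close[OF w[of m] v] by linarith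
  qed
  have small: "\<exists>N. \<forall>n\<ge>N. 1 / real (Suc n) < e" if e: "e > 0" for e :: real
  proof -
    obtain N where "inverse (real (Suc N)) < e"
      using reals_Archimedean[OF e] by blast
    moreover have "1 / real (Suc n) \<le> inverse (real (Suc N))" if "n \<ge> N" for n
      using that by (simp add: field_simps)
    ultimately have "\<forall>n\<ge>N. 1 / real (Suc n) < e"
      by (meson le_less_trans)
    then show ?thesis by blast
  qed
  have "Cauchy w"
  proof (rule CauchyI)
    fix e :: real assume "e > 0"
    then obtain N where "\<forall>n\<ge>N. 1 / real (Suc n) < e / 2"
      using small[of "e / 2"] by auto
    then have "norm (w m - w n) < e" if "m \<ge> N" "n \<ge> N" for m n
      using close[of m n] that by (smt (verit) field_sum_of_halves)
    then show "\<exists>M. \<forall>m\<ge>M. \<forall>n\<ge>M. norm (w m - w n) < e" by blast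
  qed
  then obtain l where l: "w \<longlonglongrightarrow> l"
    using Cauchy_convergent_iff convergent_def by blast
  have "approx_mean f l e" if e: "e > 0" for e
  proof -
    obtain N where N: "\<forall>n\<ge>N. 1 / real (Suc n) < e / 2"
      using small[of "e / 2"] e by auto
    obtain M where "\<forall>n\<ge>M. norm (w n - l) < e / 2"
      using LIMSEQ_D[OF l, of "e / 2"] e by auto
    then have n: "norm (w (max N M) - l) < e / 2" "1 / real (Suc (max N M)) < e / 2"
      using N by simp_all
    obtain xs where xs: "xs \<noteq> []" "set xs \<subseteq> carrier G" 
      "\<forall>x\<in>carrier G. norm (avg xs (\<lambda>a. f (a \<otimes> x)) - w (max N M)) \<le> 1 / real (Suc (max N M))"
      using w[of "max N M"] unfolding approx_mean_def by blast
    have "norm (avg xs (\<lambda>a. f (a \<otimes> x)) - l) \<le> e" if "x \<in> carrier G" for x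
    proof -
      have "avg xs (\<lambda>a. f (a \<otimes> x)) - l = (avg xs (\<lambda>a. f (a \<otimes> x)) - w (max N M)) + (w (max N M) - l)" by simp
      also have "norm \<dots> \<le> 1 / real (Suc (max N M)) + e / 2"
        using xs(3) that n by (intro norm_triangle_mono) auto
      finally show ?thesis using n by linarith
    qed
    then show ?thesis
      using xs unfolding approx_mean_def by blast
  qed
  then show ?thesis by blast
qed

lemma le_zero_of_le_epsilons:
  fixes x :: real
  assumes "\<And>e. e > 0 \<Longrightarrow> x \<le> e + e"
  shows "x \<le> 0"
  using assms[of "x / 3"] by (cases "x > 0") auto

text \<open>Compares a mean by left translates with one by right translates. Two means of
  \<open>f\<close> of the same kind agree because both equal one of the other kind.\<close>

lemma approx_mean_unique:
  assumes "\<forall>e>0. approx_mean f w e" "\<forall>e>0. approx_mean (\<lambda>x. f (inv x)) w' e"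
  shows "w = w'"
proof -
  have "norm (w - w') \<le> 0"
    by (rule le_zero_of_le_epsilons) (use assms approx_mean_close in blast)
  then show ?thesis by simp
qed

lemma mean_eqI:
  fixes f :: "'g \<Rightarrow> 'b::banach"
  assumes "cont f" "\<And>e. e > 0 \<Longrightarrow> approx_mean f w e"
  shows "mean f = w"
  unfolding mean_def
proof (rule the_equality)
  show "\<forall>e>0. approx_mean f w e" using assms by blast
  fix v assume "\<forall>e>0. approx_mean f v e"
  then show "v = w"
    using ex_mean[OF cont_inv[OF assms(1)]] approx_mean_unique assms(2) by metis
qed

lemma approx_mean_mean:
  fixes f :: "'g \<Rightarrow> 'b::banach"
  assumes "cont f" "e > 0"
  shows "approx_mean f (mean f) e"
  using ex_mean[OF assms(1)] mean_eqI[OF assms(1)] assms(2) by blast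

lemma mean_approx:
  fixes f :: "'g \<Rightarrow> 'b::banach"
  assumes "cont f" "e > 0"
  obtains xs where "xs \<noteq> []" "set xs \<subseteq> carrier G"
    "\<And>x. x \<in> carrier G \<Longrightarrow> norm (avg xs (\<lambda>a. f (a \<otimes> x)) - mean f) \<le> e"
  using approx_mean_mean[OF assms] unfolding approx_mean_def by blast

lemma approx_mean_cong:
  assumes eq: "\<And>x. x \<in> carrier G \<Longrightarrow> f x = g x" and f: "approx_mean f w e"
  shows "approx_mean g w e"
proof -
  obtain xs where xs: "xs \<noteq> []" "set xs \<subseteq> carrier G"
    "\<forall>x\<in>carrier G. norm (avg xs (\<lambda>a. f (a \<otimes> x)) - w) \<le> e"
    using f unfolding approx_mean_def by blast
  have "avg xs (\<lambda>a. g (a \<otimes> x)) = avg xs (\<lambda>a. f (a \<otimes> x))" if "x \<in> carrier G" for x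
    using that xs(2) by (intro avg_cong eq[symmetric]) auto
  then show ?thesis
    using xs unfolding approx_mean_def by auto
qed

lemma mean_cong:
  fixes f :: "'g \<Rightarrow> 'b::real_normed_vector"
  assumes "\<And>x. x \<in> carrier G \<Longrightarrow> f x = g x"
  shows "mean f = mean g"
proof -
  have "approx_mean f w e \<longleftrightarrow> approx_mean g w e" for w e
    using approx_mean_cong[of f g] approx_mean_cong[of g f] assms by auto
  then show ?thesis by (simp add: mean_def)
qed

section \<open>Invariance, linearity and positivity of the mean\<close>

lemma mean_inv:
  fixes f :: "'g \<Rightarrow> 'b::banach"
  assumes "cont f"
  shows "mean (\<lambda>x. f (inv x)) = mean f"
  using approx_mean_unique[of f "mean f" "mean (\<lambda>x. f (inv x))"] approx_mean_mean assms cont_inv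
  by metis

lemma mean_right:
  fixes f :: "'g \<Rightarrow> 'b::banach"
  assumes f: "cont f" and k: "k \<in> carrier G"
  shows "mean (\<lambda>x. f (x \<otimes> k)) = mean f"
proof (rule mean_eqI[OF cont_right[OF assms]])
  fix e :: real assume "e > 0"
  then obtain xs where xs: "xs \<noteq> []" "set xs \<subseteq> carrier G"
    "\<And>x. x \<in> carrier G \<Longrightarrow> norm (avg xs (\<lambda>a. f (a \<otimes> x)) - mean f) \<le> e"
    using mean_approx[OF f] by blast
  have "norm (avg xs (\<lambda>a. f (a \<otimes> x \<otimes> k)) - mean f) \<le> e" if x: "x \<in> carrier G" for x
  proof -
    have "avg xs (\<lambda>a. f (a \<otimes> x \<otimes> k)) = avg xs (\<lambda>a. f (a \<otimes> (x \<otimes> k)))"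
      using xs x k by (intro avg_cong) (auto simp: m_assoc subset_iff)
    then show ?thesis using xs(3)[of "x \<otimes> k"] x k by simp
  qed
  then show "approx_mean (\<lambda>x. f (x \<otimes> k)) (mean f) e"
    using xs unfolding approx_mean_def by blast
qed

text \<open>Right invariance is built into \<open>approx_mean\<close>, whose estimate holds at every
  point; left invariance results from it by passing through inversion.\<close>

lemma mean_left:
  fixes f :: "'g \<Rightarrow> 'b::banach"
  assumes f: "cont f" and k: "k \<in> carrier G"
  shows "mean (\<lambda>x. f (k \<otimes> x)) = mean f"
proof -
  have "mean (\<lambda>x. f (k \<otimes> x)) = mean (\<lambda>x. f (k \<otimes> inv x))"
    using mean_inv[OF cont_left[OF assms]] by simp
  also have "\<dots> = mean (\<lambda>x. f (inv (x \<otimes> inv k)))"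
    using k by (intro mean_cong) (simp add: inv_mult_group)
  also have "\<dots> = mean f"
    using mean_right[OF cont_inv[OF f], of "inv k"] mean_inv[OF f] k by simp
  finally show ?thesis .
qed

lemma mean_const [simp]:
  fixes c :: "'b::banach"
  shows "mean (\<lambda>_. c) = c"
proof (rule mean_eqI)
  show "approx_mean (\<lambda>_. c) c e" if "e > 0" for e
    unfolding approx_mean_def by (rule exI[of _ "[\<one>]"]) (use that in \<open>simp add: avg_def\<close>)
qed simp

lemma mean_bounded_linear:
  fixes f :: "'g \<Rightarrow> 'b::banach" and L :: "'b \<Rightarrow> 'c::banach"
  assumes f: "cont f" and L: "bounded_linear L"
  shows "cont (\<lambda>x. L (f x))" "mean (\<lambda>x. L (f x)) = L (mean f)"
proof -
  have "continuous_map euclidean euclidean L"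
    using L by (simp add: linear_continuous_on)
  from continuous_map_compose[OF f this] show c: "cont (\<lambda>x. L (f x))"
    by (simp add: o_def)
  show "mean (\<lambda>x. L (f x)) = L (mean f)"
  proof (rule mean_eqI[OF c])
    fix e :: real assume e: "e > 0"
    obtain K where K: "K > 0" "\<And>x. norm (L x) \<le> norm x * K"
      using bounded_linear.pos_bounded[OF L] by blast
    have "e / K > 0" using e K by simp
    then obtain xs where xs: "xs \<noteq> []" "set xs \<subseteq> carrier G"
      "\<And>x. x \<in> carrier G \<Longrightarrow> norm (avg xs (\<lambda>a. f (a \<otimes> x)) - mean f) \<le> e / K"
      using mean_approx[OF f] by blast
    have "norm (avg xs (\<lambda>a. L (f (a \<otimes> x))) - L (mean f)) \<le> e" if x: "x \<in> carrier G" for x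
    proof -
      have "avg xs (\<lambda>a. L (f (a \<otimes> x))) - L (mean f) = L (avg xs (\<lambda>a. f (a \<otimes> x)) - mean f)"
        using L by (simp add: linear_avg[OF bounded_linear.linear[OF L]] linear_diff bounded_linear.linear)
      also have "norm \<dots> \<le> e / K * K"
        using K(2) xs(3)[OF x] K(1) by (meson mult_right_mono less_imp_le order_trans)
      finally show ?thesis using K by simp
    qed
    then show "approx_mean (\<lambda>x. L (f x)) (L (mean f)) e"
      using xs unfolding approx_mean_def by blast
  qed
qed

lemma cont_avg_left:
  assumes "cont f" "set xs \<subseteq> carrier G"
  shows "cont (\<lambda>x. avg xs (\<lambda>a. f (a \<otimes> x)))"
  using assms by (intro continuous_map_avg cont_left) auto

text \<open>This has to precede additivity, whose proof uses it. Composed with inversion, the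
  averages that approximate the mean act on the other side of the argument and therefore commute
  with those over \<open>xs\<close>.\<close>

lemma mean_avg_left:
  fixes f :: "'g \<Rightarrow> 'b::banach"
  assumes f: "cont f" and xs: "xs \<noteq> []" "set xs \<subseteq> carrier G"
  shows "mean (\<lambda>x. avg xs (\<lambda>a. f (a \<otimes> x))) = mean f"
proof -
  let ?g = "\<lambda>x. avg xs (\<lambda>a. f (a \<otimes> x))"
  have "mean (\<lambda>x. ?g (inv x)) = mean f"
  proof (rule mean_eqI[OF cont_inv[OF cont_avg_left[OF f xs(2)]]])
    fix e :: real assume "e > 0"
    then obtain ys where ys: "ys \<noteq> []" "set ys \<subseteq> carrier G"
      "\<And>x. x \<in> carrier G \<Longrightarrow> norm (avg ys (\<lambda>b. f (inv (b \<otimes> x))) - mean f) \<le> e"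
      using mean_approx[OF cont_inv[OF f]] mean_inv[OF f] by metis
    have "norm (avg ys (\<lambda>b. ?g (inv (b \<otimes> x))) - mean f) \<le> e" if x: "x \<in> carrier G" for x
    proof -
      have "avg ys (\<lambda>b. ?g (inv (b \<otimes> x))) = avg xs (\<lambda>a. avg ys (\<lambda>b. f (a \<otimes> inv (b \<otimes> x))))"
        by (rule avg_swap)
      also have "\<dots> = avg xs (\<lambda>a. avg ys (\<lambda>b. f (inv (b \<otimes> (x \<otimes> inv a)))))"
        using x xs ys by (intro avg_cong) (auto simp: inv_mult_group m_assoc subset_iff)
      also have "norm (\<dots> - mean f) \<le> e"
        using xs x by (intro norm_avg_diff_le ys(3)) auto
      finally show ?thesis .
    qed
    then show "approx_mean (\<lambda>x. ?g (inv x)) (mean f) e"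
      using ys unfolding approx_mean_def by blast
  qed
  then show ?thesis
    using mean_inv[OF cont_avg_left[OF f xs(2)]] by simp
qed

text \<open>Both functions need a common list. \<open>xs\<close> is good for \<open>f\<close>, and
  \<open>ys\<close> is good for the \<open>xs\<close>-average of \<open>g\<close>, which has the
  same mean as \<open>g\<close>. The list of products serves both, since further averaging does not
  spoil the estimate for \<open>f\<close>.\<close>

lemma mean_add:
  fixes f g :: "'g \<Rightarrow> 'b::banach"
  assumes f: "cont f" and g: "cont g"
  shows "mean (\<lambda>x. f x + g x) = mean f + mean g"
proof (rule mean_eqI)
  show "cont (\<lambda>x. f x + g x)" using assms by (rule continuous_map_add)
  fix e :: real assume "e > 0"
  then have e: "e / 2 > 0" by simp
  obtain xs where xs: "xs \<noteq> []" "set xs \<subseteq> carrier G"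
    "\<And>x. x \<in> carrier G \<Longrightarrow> norm (avg xs (\<lambda>a. f (a \<otimes> x)) - mean f) \<le> e / 2"
    using mean_approx[OF f e] by blast
  obtain ys where ys: "ys \<noteq> []" "set ys \<subseteq> carrier G"
    "\<And>x. x \<in> carrier G \<Longrightarrow> norm (avg ys (\<lambda>b. avg xs (\<lambda>a. g (a \<otimes> (b \<otimes> x)))) - mean g) \<le> e / 2"
    using mean_approx[OF cont_avg_left[OF g xs(2)] e] mean_avg_left[OF g xs(1,2)] by metis
  define zs where "zs = map (\<lambda>(b, a). a \<otimes> b) (List.product ys xs)"
  have zs: "avg zs (\<lambda>a. h (a \<otimes> x)) = avg ys (\<lambda>b. avg xs (\<lambda>a. h (a \<otimes> (b \<otimes> x))))"
    if "x \<in> carrier G" for h :: "'g \<Rightarrow> 'b" and x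
  proof -
    have "avg zs (\<lambda>a. h (a \<otimes> x)) = avg ys (\<lambda>b. avg xs (\<lambda>a. h (a \<otimes> b \<otimes> x)))"
      unfolding zs_def avg_map avg_product by (simp add: case_prod_unfold)
    also have "\<dots> = avg ys (\<lambda>b. avg xs (\<lambda>a. h (a \<otimes> (b \<otimes> x))))"
      using xs ys that by (intro avg_cong) (auto simp: m_assoc subset_iff)
    finally show ?thesis .
  qed
  have "norm (avg zs (\<lambda>a. f (a \<otimes> x) + g (a \<otimes> x)) - (mean f + mean g)) \<le> e" if x: "x \<in> carrier G" for x
  proof -
    have "avg zs (\<lambda>a. f (a \<otimes> x) + g (a \<otimes> x)) - (mean f + mean g) =
      (avg zs (\<lambda>a. f (a \<otimes> x)) - mean f) + (avg zs (\<lambda>a. g (a \<otimes> x)) - mean g)"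
      by (simp add: avg_add)
    also have "norm \<dots> \<le> e / 2 + e / 2"
    proof (rule norm_triangle_mono)
      show "norm (avg zs (\<lambda>a. f (a \<otimes> x)) - mean f) \<le> e / 2"
        using ys x by (subst zs[OF x], intro norm_avg_diff_le xs(3)) auto
      show "norm (avg zs (\<lambda>a. g (a \<otimes> x)) - mean g) \<le> e / 2"
        using ys(3)[OF x] by (simp add: zs x)
    qed
    finally show ?thesis by simp
  qed
  moreover have "zs \<noteq> []" "set zs \<subseteq> carrier G"
    using xs(1,2) ys(1,2) by (cases xs; cases ys; auto simp: zs_def)+
  ultimately show "approx_mean (\<lambda>x. f x + g x) (mean f + mean g) e"
    unfolding approx_mean_def by blast
qed

lemma mean_scaleR:
  fixes f :: "'g \<Rightarrow> 'b::banach"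
  assumes "cont f"
  shows "mean (\<lambda>x. c *\<^sub>R f x) = c *\<^sub>R mean f"
  using mean_bounded_linear(2)[OF assms bounded_linear_scaleR_right] .

lemma mean_cmult:
  fixes f :: "'g \<Rightarrow> real"
  assumes "cont f"
  shows "mean (\<lambda>x. c * f x) = c * mean f"
  using mean_scaleR[OF assms, of c] by simp

lemma mean_diff:
  fixes f g :: "'g \<Rightarrow> 'b::banach"
  assumes f: "cont f" and g: "cont g"
  shows "mean (\<lambda>x. f x - g x) = mean f - mean g"
  using mean_add[OF f continuous_map_minus[OF g]] mean_scaleR[OF g, of "-1"] by simp

lemma mean_sum:
  fixes f :: "'i \<Rightarrow> 'g \<Rightarrow> 'b::banach"
  assumes "finite I" "\<And>i. i \<in> I \<Longrightarrow> cont (f i)"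
  shows "mean (\<lambda>x. \<Sum>i\<in>I. f i x) = (\<Sum>i\<in>I. mean (f i))"
  using assms
  by (induction I) (auto simp: mean_add continuous_map_sum)

lemma mean_avg:
  fixes f :: "'g \<Rightarrow> 'i \<Rightarrow> 'b::banach"
  assumes "\<And>a. a \<in> set xs \<Longrightarrow> cont (\<lambda>x. f x a)"
  shows "mean (\<lambda>x. avg xs (f x)) = avg xs (\<lambda>a. mean (\<lambda>x. f x a))"
proof -
  have "cont (\<lambda>x. \<Sum>a\<leftarrow>xs. f x a) \<and> mean (\<lambda>x. \<Sum>a\<leftarrow>xs. f x a) = (\<Sum>a\<leftarrow>xs. mean (\<lambda>x. f x a))"
    using assms by (induction xs) (auto simp: mean_add continuous_map_add)
  then show ?thesis unfolding avg_def by (simp add: mean_scaleR)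
qed

lemma mean_in_closed_subspace:
  fixes f :: "'g \<Rightarrow> 'b::banach"
  assumes f: "cont f" and V: "subspace V" "closed V" "\<And>x. x \<in> carrier G \<Longrightarrow> f x \<in> V"
  shows "mean f \<in> V"
proof -
  have "\<exists>y\<in>V. dist y (mean f) < e" if "e > 0" for e
  proof -
    have "e / 2 > 0" using that by simp
    then obtain xs where xs: "xs \<noteq> []" "set xs \<subseteq> carrier G"
      "\<And>x. x \<in> carrier G \<Longrightarrow> norm (avg xs (\<lambda>a. f (a \<otimes> x)) - mean f) \<le> e / 2"
      using mean_approx[OF f] by blast
    have "(\<Sum>a\<leftarrow>xs. f (a \<otimes> \<one>)) \<in> V"
      using xs(2) V by (induction xs) (auto simp: subspace_0 subspace_add)
    then have "avg xs (\<lambda>a. f (a \<otimes> \<one>)) \<in> V"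
      unfolding avg_def using V(1) by (simp add: subspace_scale)
    then show ?thesis
      using xs(3)[OF one_closed] that by (force simp: dist_norm)
  qed
  then show ?thesis
    using V(2) closure_approachable[of "mean f" V] by (simp add: closure_closed)
qed

lemma norm_mean_diff_le:
  fixes f :: "'g \<Rightarrow> 'b::banach"
  assumes f: "cont f" and le: "\<And>x. x \<in> carrier G \<Longrightarrow> norm (f x - w) \<le> C"
  shows "norm (mean f - w) \<le> C"
proof (rule field_le_epsilon)
  fix e :: real assume "e > 0"
  then obtain xs where xs: "xs \<noteq> []" "set xs \<subseteq> carrier G"
    "\<And>x. x \<in> carrier G \<Longrightarrow> norm (avg xs (\<lambda>a. f (a \<otimes> x)) - mean f) \<le> e"
    using mean_approx[OF f] by blast
  have "norm (avg xs (\<lambda>a. f (a \<otimes> \<one>)) - w) \<le> C"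
    using xs by (intro norm_avg_diff_le le) auto
  moreover have "mean f - w = (avg xs (\<lambda>a. f (a \<otimes> \<one>)) - w) - (avg xs (\<lambda>a. f (a \<otimes> \<one>)) - mean f)"
    by simp
  then have "norm (mean f - w) \<le> norm (avg xs (\<lambda>a. f (a \<otimes> \<one>)) - w) + norm (avg xs (\<lambda>a. f (a \<otimes> \<one>)) - mean f)"
    by (metis norm_triangle_ineq4)
  ultimately show "norm (mean f - w) \<le> C + e"
    using xs(3)[OF one_closed] by linarith
qed

lemma norm_mean_le:
  fixes f :: "'g \<Rightarrow> 'b::banach"
  assumes "cont f" "\<And>x. x \<in> carrier G \<Longrightarrow> norm (f x) \<le> C"
  shows "norm (mean f) \<le> C"
  using norm_mean_diff_le[OF assms(1), of 0 C] assms(2) by simp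

lemma bounded_cont:
  fixes f :: "'g \<Rightarrow> 'b::real_normed_vector"
  assumes "cont f"
  obtains C where "C > 0" "\<And>x. x \<in> carrier G \<Longrightarrow> norm (f x) \<le> C"
proof -
  have "continuous_map (prod_topology T (discrete_topology {()})) euclidean (\<lambda>(x, t). f x)"
    using continuous_comp[OF assms continuous_map_fst] by (simp add: case_prod_unfold)
  then obtain C where "C > 0" "\<And>x t. x \<in> carrier G \<Longrightarrow> t \<in> topspace (discrete_topology {()}) \<Longrightarrow> norm (f x) \<le> C"
    using bounded_parameter[of "discrete_topology {()}" "\<lambda>x t. f x"]
    by (auto simp: compact_space_discrete_topology)
  then show thesis
    using that[of C] by auto
qed

lemma mean_nonneg:
  fixes f :: "'g \<Rightarrow> real"
  assumes f: "cont f" and nn: "\<And>x. x \<in> carrier G \<Longrightarrow> f x \<ge> 0"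
  shows "mean f \<ge> 0"
proof -
  obtain C where C: "C > 0" "\<And>x. x \<in> carrier G \<Longrightarrow> norm (f x) \<le> C"
    using bounded_cont[OF f] by blast
  \<comment> \<open>The values lie between 0 and C, hence in the ball of radius C about C, which the
    mean does not leave.\<close>
  have "norm (mean f - C) \<le> C"
    using C(2) nn by (intro norm_mean_diff_le[OF f]) (force simp: abs_le_iff)
  then show ?thesis by auto
qed

lemma mean_mono:
  fixes f g :: "'g \<Rightarrow> real"
  assumes "cont f" "cont g" "\<And>x. x \<in> carrier G \<Longrightarrow> f x \<le> g x"
  shows "mean f \<le> mean g"
  using mean_nonneg[of "\<lambda>x. g x - f x"] assms mean_diff[OF assms(2,1)] by (simp add: continuous_map_diff)

text \<open>Finitely many translates of the set where \<open>f\<close> exceeds \<open>f x / 2\<close> cover the group.\<close>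
lemma mean_pos:
  fixes f :: "'g \<Rightarrow> real"
  assumes f: "cont f" and nn: "\<And>x. x \<in> carrier G \<Longrightarrow> f x \<ge> 0" and x: "x \<in> carrier G" "f x > 0"
  shows "mean f > 0"
proof -
  have "continuous_map (prod_topology T (discrete_topology {()})) euclidean (\<lambda>(x, t). f x)"
    using continuous_comp[OF f continuous_map_fst] by (simp add: case_prod_unfold)
  note F = this
  have Y: "compact_space (discrete_topology {()})"
    by (simp add: compact_space_discrete_topology)
  have e: "f x / 2 > 0"
    using x by simp
  obtain A where A: "finite A" "A \<noteq> {}" "A \<subseteq> carrier G" and
    net: "\<And>y. y \<in> carrier G \<Longrightarrow> \<exists>i\<in>A. \<forall>a\<in>carrier G. \<forall>t\<in>topspace (discrete_topology {()}).
      norm (f (a \<otimes> (i \<otimes> y)) - f a) < f x / 2"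
    by (rule finite_net[where F = "\<lambda>x t. f x", OF Y F e]) (rule that; (assumption | blast))
  have c: "cont (\<lambda>y. f (x \<otimes> i \<otimes> y))" if "i \<in> A" for i
    using that A x by (intro cont_left[OF f]) auto
  have "f x / 2 \<le> (\<Sum>i\<in>A. f (x \<otimes> i \<otimes> y))" if y: "y \<in> carrier G" for y
  proof -
    obtain i where i: "i \<in> A" "\<bar>f (x \<otimes> (i \<otimes> y)) - f x\<bar> < f x / 2"
      using net[OF y] x by auto
    then have "f x / 2 \<le> f (x \<otimes> (i \<otimes> y))"
      by linarith
    also have "\<dots> = f (x \<otimes> i \<otimes> y)"
      using A(3) i x y by (subst m_assoc) auto
    also have "\<dots> \<le> (\<Sum>i\<in>A. f (x \<otimes> i \<otimes> y))"
      using A i x y by (intro member_le_sum nn) auto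
    finally show ?thesis .
  qed
  then have "mean (\<lambda>_. f x / 2) \<le> mean (\<lambda>y. \<Sum>i\<in>A. f (x \<otimes> i \<otimes> y))"
    using c A by (intro mean_mono continuous_map_sum) auto
  also have "\<dots> = (\<Sum>i\<in>A. mean (\<lambda>y. f (x \<otimes> i \<otimes> y)))"
    using c A by (intro mean_sum) auto
  also have "\<dots> = (\<Sum>i\<in>A. mean f)"
    using A x by (intro sum.cong refl mean_left[OF f]) auto
  finally have "f x / 2 \<le> card A * mean f" by simp
  moreover have "mean f \<ge> 0" using mean_nonneg[OF f nn] .
  ultimately show ?thesis
    using x by (cases "mean f = 0") auto
qed

text \<open>One list serves all parameters because the oscillation estimate is uniform in
  \<open>t\<close>. The exact mean is reached by comparison with approximations of arbitrary
  accuracy \<open>d\<close> from the inverted side.\<close>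

lemma mean_approx_uniform:
  fixes F :: "'g \<Rightarrow> 'y \<Rightarrow> 'b::banach"
  assumes Y: "compact_space Y" and F: "continuous_map (prod_topology T Y) euclidean (\<lambda>(x, t). F x t)"
    and e: "e > 0"
  obtains xs where "xs \<noteq> []" "set xs \<subseteq> carrier G"
    "\<And>x t. x \<in> carrier G \<Longrightarrow> t \<in> topspace Y \<Longrightarrow>
      norm (avg xs (\<lambda>a. F (a \<otimes> x) t) - mean (\<lambda>x. F x t)) \<le> e"
proof -
  obtain xs where xs: "xs \<noteq> []" "set xs \<subseteq> carrier G"
    and osc: "\<And>x y t. x \<in> carrier G \<Longrightarrow> y \<in> carrier G \<Longrightarrow> t \<in> topspace Y \<Longrightarrow>
      norm (avg xs (\<lambda>a. F (a \<otimes> x) t) - avg xs (\<lambda>a. F (a \<otimes> y) t)) \<le> e"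
    using avg_almost_constant[OF Y F e] by blast
  have "norm (avg xs (\<lambda>a. F (a \<otimes> x) t) - mean (\<lambda>x. F x t)) \<le> e"
    if x: "x \<in> carrier G" and t: "t \<in> topspace Y" for x t
  proof (rule field_le_epsilon)
    fix d :: real assume d: "d > 0"
    have "continuous_map T (prod_topology T Y) (\<lambda>x. (x, t))"
      using t by (intro continuous_map_pairedI) auto
    from continuous_map_compose[OF this F] have c: "cont (\<lambda>x. F x t)"
      by (simp add: o_def)
    have "approx_mean (\<lambda>x. F x t) (avg xs (\<lambda>a. F (a \<otimes> x) t)) e"
      using xs osc x t by (intro approx_mean_of_oscillation) auto
    moreover have "approx_mean (\<lambda>x. F (inv x) t) (mean (\<lambda>x. F x t)) d"
      using approx_mean_mean[OF cont_inv[OF c] d] mean_inv[OF c] by simp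
    ultimately show "norm (avg xs (\<lambda>a. F (a \<otimes> x) t) - mean (\<lambda>x. F x t)) \<le> e + d"
      by (rule approx_mean_close)
  qed
  then show thesis using that xs by blast
qed

lemma continuous_map_mean_parameter:
  fixes F :: "'g \<Rightarrow> 'y \<Rightarrow> 'b::banach"
  assumes Y: "compact_space Y" and F: "continuous_map (prod_topology T Y) euclidean (\<lambda>(x, t). F x t)"
  shows "continuous_map Y euclidean (\<lambda>t. mean (\<lambda>x. F x t))"
  unfolding continuous_map_euclidean_dist
proof (intro ballI allI impI)
  fix t and e :: real assume t: "t \<in> topspace Y" and "e > 0"
  then have e: "e / 2 > 0" by simp
  obtain V where V: "openin Y V" "t \<in> V"
    "\<And>x s. x \<in> topspace T \<Longrightarrow> s \<in> V \<Longrightarrow> dist (F x s) (F x t) < e / 2"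
    using uniform_in_compact_parameter[OF compact F t e] by auto
  have c: "cont (\<lambda>x. F x s)" if "s \<in> topspace Y" for s
  proof -
    have "continuous_map T (prod_topology T Y) (\<lambda>x. (x, s))"
      using that by (intro continuous_map_pairedI) auto
    from continuous_map_compose[OF this F] show ?thesis by (simp add: o_def)
  qed
  have "dist (mean (\<lambda>x. F x s)) (mean (\<lambda>x. F x t)) < e" if s: "s \<in> V" for s
  proof -
    have s': "s \<in> topspace Y" using V(1) s openin_subset by blast
    have "norm (mean (\<lambda>x. F x s - F x t)) \<le> e / 2"
      using V(3) s c[OF s'] c[OF t]
      by (intro norm_mean_le continuous_map_diff) (auto simp: dist_norm topspace_eq intro: less_imp_le)
    then show ?thesis
      using \<open>e > 0\<close> by (simp add: mean_diff[OF c[OF s'] c[OF t]] dist_norm)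
  qed
  then show "\<exists>V. openin Y V \<and> t \<in> V \<and> (\<forall>s\<in>V. dist (mean (\<lambda>x. F x s)) (mean (\<lambda>x. F x t)) < e)"
    using V by blast
qed

text \<open>Fubini: the mean over x is approximated, uniformly in y, by a finite average, and finite
  averages commute with the mean over y.\<close>

lemma mean_swap:
  fixes F :: "'g \<Rightarrow> 'g \<Rightarrow> 'b::banach"
  assumes F: "continuous_map (prod_topology T T) euclidean (\<lambda>(x, y). F x y)"
  shows "mean (\<lambda>x. mean (\<lambda>y. F x y)) = mean (\<lambda>y. mean (\<lambda>x. F x y))"
proof -
  have F': "continuous_map (prod_topology T T) euclidean (\<lambda>(y, x). F x y)"
    using continuous_map_compose[OF continuous_map_pairedI[OF continuous_map_snd continuous_map_fst] F]
    by (simp add: o_def case_prod_unfold)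
  have cy: "cont (\<lambda>y. F x y)" if "x \<in> carrier G" for x
  proof -
    have "continuous_map T (prod_topology T T) (\<lambda>y. (x, y))"
      using that by (intro continuous_map_pairedI) (auto simp: topspace_eq)
    from continuous_map_compose[OF this F] show ?thesis by (simp add: o_def)
  qed
  have cM: "cont (\<lambda>y. mean (\<lambda>x. F x y))"
    by (rule continuous_map_mean_parameter[OF compact F])
  show ?thesis
  proof (rule mean_eqI[OF continuous_map_mean_parameter[OF compact F']])
    fix e :: real assume "e > 0"
    then obtain xs where xs: "xs \<noteq> []" "set xs \<subseteq> carrier G"
      and le: "\<And>x y. x \<in> carrier G \<Longrightarrow> y \<in> carrier G \<Longrightarrow>
        norm (avg xs (\<lambda>a. F (a \<otimes> x) y) - mean (\<lambda>x. F x y)) \<le> e"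
      using mean_approx_uniform[OF compact F] unfolding topspace_eq by metis
    have "norm (avg xs (\<lambda>a. mean (\<lambda>y. F (a \<otimes> x) y)) - mean (\<lambda>y. mean (\<lambda>x. F x y))) \<le> e"
      if x: "x \<in> carrier G" for x
    proof -
      have c: "cont (\<lambda>y. F (a \<otimes> x) y)" if "a \<in> set xs" for a
        using that xs x by (intro cy) auto
      have "avg xs (\<lambda>a. mean (\<lambda>y. F (a \<otimes> x) y)) = mean (\<lambda>y. avg xs (\<lambda>a. F (a \<otimes> x) y))"
        using c by (rule mean_avg[symmetric])
      then have "avg xs (\<lambda>a. mean (\<lambda>y. F (a \<otimes> x) y)) - mean (\<lambda>y. mean (\<lambda>x. F x y)) =
          mean (\<lambda>y. avg xs (\<lambda>a. F (a \<otimes> x) y) - mean (\<lambda>x. F x y))"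
        using c cM by (simp add: mean_diff continuous_map_avg)
      also have "norm \<dots> \<le> e"
        using c cM le x by (intro norm_mean_le continuous_map_diff continuous_map_avg) auto
      finally show ?thesis .
    qed
    then show "approx_mean (\<lambda>x. mean (\<lambda>y. F x y)) (mean (\<lambda>y. mean (\<lambda>x. F x y))) e"
      using xs unfolding approx_mean_def by blast
  qed
qed

end

section \<open>The Hahn--Banach theorem\<close>

lemma is_projection_ontoI:
  assumes "bounded_linear P" "\<And>x. P x \<in> V" "\<And>v. v \<in> V \<Longrightarrow> P v = v"
  shows "is_projection_onto V P"
  unfolding is_projection_onto_def
proof (intro conjI equalityI subsetI ballI)
  fix v assume "v \<in> V"
  then show "v \<in> range P" using assms(3)[of v] by (metis rangeI)
qed (use assms in auto)

text \<open>For scaling an inequality suffices, as applying it to the reciprocal factor gives the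
  converse; this keeps verifications short.\<close>

definition sublinear :: "('w::real_vector \<Rightarrow> real) \<Rightarrow> bool" where
  "sublinear p \<longleftrightarrow> (\<forall>x y. p (x + y) \<le> p x + p y) \<and> (\<forall>c>0. \<forall>x. p (c *\<^sub>R x) \<le> c * p x)"

lemma sublinear_scale:
  assumes "sublinear p" "c > 0"
  shows "p (c *\<^sub>R x) = c * p x"
proof (rule antisym)
  show "p (c *\<^sub>R x) \<le> c * p x"
    using assms by (simp add: sublinear_def)
  have "p ((1 / c) *\<^sub>R (c *\<^sub>R x)) \<le> 1 / c * p (c *\<^sub>R x)"
    using assms unfolding sublinear_def by (metis zero_less_divide_1_iff)
  then show "c * p x \<le> p (c *\<^sub>R x)"
    using assms(2) by (simp add: field_simps)
qed

lemma sublinear_zero: "sublinear p \<Longrightarrow> p 0 = 0"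
  using sublinear_scale[of p 2 0] by simp

lemma sublinear_neg: "sublinear p \<Longrightarrow> - p (- x) \<le> p x"
  using sublinear_zero[of p] unfolding sublinear_def by (metis add.right_inverse add_le_cancel_left
      add.commute diff_0 diff_le_eq minus_diff_eq)

text \<open>The auxiliary functional of the Hahn--Banach argument. It is finite because its terms
  are bounded below by \<open>- p (- x)\<close>; \<open>t = 0\<close> shows that it does not exceed
  \<open>p\<close>, and \<open>t = 1\<close> that its value at \<open>- z\<close> is at most
  \<open>- p z\<close>.\<close>

definition sublinear_shift :: "('w::real_vector \<Rightarrow> real) \<Rightarrow> 'w \<Rightarrow> 'w \<Rightarrow> real" where
  "sublinear_shift p z x = (INF t\<in>{0..}. p (x + t *\<^sub>R z) - t * p z)"

lemma sublinear_shift_bound: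
  assumes p: "sublinear p" and t: "t \<ge> 0"
  shows "- p (- x) \<le> p (x + t *\<^sub>R z) - t * p z"
proof -
  have "t * p z = p (t *\<^sub>R z)"
    using sublinear_scale[OF p, of t z] sublinear_zero[OF p] t by (cases "t = 0") auto
  also have "\<dots> = p ((x + t *\<^sub>R z) + - x)" by simp
  also have "\<dots> \<le> p (x + t *\<^sub>R z) + p (- x)"
    using p unfolding sublinear_def by blast
  finally show ?thesis by simp
qed

lemma sublinear_shift_le:
  assumes "sublinear p" "t \<ge> 0"
  shows "sublinear_shift p z x \<le> p (x + t *\<^sub>R z) - t * p z"
  unfolding sublinear_shift_def
  using assms by (intro cINF_lower bdd_belowI2[of _ "- p (- x)"] sublinear_shift_bound) auto

lemma le_sublinear_shift:
  assumes "\<And>t. t \<ge> 0 \<Longrightarrow> m \<le> p (x + t *\<^sub>R z) - t * p z"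
  shows "m \<le> sublinear_shift p z x"
  unfolding sublinear_shift_def using assms by (intro cINF_greatest) auto

text \<open>Parameters add: t for x and s for y give t + s for x + y, after which the two infima are
  taken one at a time. Scaling x by c scales the parameter by c.\<close>

lemma sublinear_sublinear_shift:
  assumes p: "sublinear p"
  shows "sublinear (sublinear_shift p z)"
  unfolding sublinear_def
proof (intro conjI allI impI)
  fix x y
  let ?q = "sublinear_shift p z"
  have "?q (x + y) \<le> (p (x + t *\<^sub>R z) - t * p z) + (p (y + s *\<^sub>R z) - s * p z)" if "t \<ge> 0" "s \<ge> 0" for t s
  proof -
    have "?q (x + y) \<le> p ((x + y) + (t + s) *\<^sub>R z) - (t + s) * p z"
      using that by (intro sublinear_shift_le[OF p]) auto
    also have "(x + y) + (t + s) *\<^sub>R z = (x + t *\<^sub>R z) + (y + s *\<^sub>R z)"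
      by (simp add: algebra_simps)
    also have "p \<dots> \<le> p (x + t *\<^sub>R z) + p (y + s *\<^sub>R z)"
      using p unfolding sublinear_def by blast
    finally show ?thesis by (simp add: algebra_simps)
  qed
  note le = this
  have "?q (x + y) - (p (x + t *\<^sub>R z) - t * p z) \<le> ?q y" if "t \<ge> 0" for t
  proof (rule le_sublinear_shift)
    fix s :: real assume "s \<ge> 0"
    from le[OF that this] show "?q (x + y) - (p (x + t *\<^sub>R z) - t * p z) \<le> p (y + s *\<^sub>R z) - s * p z"
      by linarith
  qed
  note le = this
  have "?q (x + y) - ?q y \<le> ?q x"
  proof (rule le_sublinear_shift)
    fix t :: real assume "t \<ge> 0"
    from le[OF this] show "?q (x + y) - ?q y \<le> p (x + t *\<^sub>R z) - t * p z"
      by linarith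
  qed
  then show "?q (x + y) \<le> ?q x + ?q y" by simp
next
  fix c :: real and x assume c: "c > 0"
  have "sublinear_shift p z (c *\<^sub>R x) / c \<le> p (x + t *\<^sub>R z) - t * p z" if "t \<ge> 0" for t
  proof -
    have "sublinear_shift p z (c *\<^sub>R x) \<le> p (c *\<^sub>R x + (c * t) *\<^sub>R z) - (c * t) * p z"
      using that c by (intro sublinear_shift_le[OF p]) auto
    also have "c *\<^sub>R x + (c * t) *\<^sub>R z = c *\<^sub>R (x + t *\<^sub>R z)"
      by (simp add: algebra_simps)
    also have "p \<dots> = c * p (x + t *\<^sub>R z)"
      by (rule sublinear_scale[OF p c])
    finally show ?thesis using c by (simp add: field_simps)
  qed
  then have "sublinear_shift p z (c *\<^sub>R x) / c \<le> sublinear_shift p z x"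
    by (rule le_sublinear_shift)
  then show "sublinear_shift p z (c *\<^sub>R x) \<le> c * sublinear_shift p z x"
    using c by (simp add: field_simps)
qed

text \<open>Hahn--Banach: a minimal sublinear functional \<open>q\<close> agrees with all its shifts, and the shift
  by \<open>z\<close> satisfies \<open>q (- z) \<le> - q z\<close>.\<close>
lemma sublinear_dominates_linear:
  fixes p :: "'w::real_vector \<Rightarrow> real"
  assumes p: "sublinear p"
  obtains f where "linear f" "\<And>x. f x \<le> p x"
proof -
  define A where "A = {q. sublinear q \<and> (\<forall>x. q x \<le> p x)}"
  \<comment> \<open>The order is reversed, so that a maximal element in the sense of Zorn's lemma is
    a minimal functional.\<close>
  define R where "R = (\<lambda>a b :: 'w \<Rightarrow> real. \<forall>x. b x \<le> a x)"
  have "partial_order_on A (relation_of R A)"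
    by (auto simp: partial_order_on_def preorder_on_def refl_on_def trans_def antisym_def relation_of_def R_def fun_eq_iff
        intro: order_trans antisym)
  moreover have "\<exists>u\<in>A. \<forall>a\<in>C. R a u" if C: "C \<in> Chains (relation_of R A)" for C
  proof (cases "C = {}")
    case True
    then show ?thesis using p by (auto simp: A_def)
  next
    case False
    have CA: "C \<subseteq> A" and chain: "\<And>a b. a \<in> C \<Longrightarrow> b \<in> C \<Longrightarrow> R a b \<or> R b a"
      using C by (auto simp: Chains_def relation_of_def)
    define u where "u x = (INF q\<in>C. q x)" for x
    have "- p (- x) \<le> q x" if "q \<in> C" for q x
    proof -
      have "sublinear q" "q (- x) \<le> p (- x)" using that CA by (auto simp: A_def)
      then show ?thesis using sublinear_neg[of q x] by linarith
    qed
    then have u_le: "u x \<le> q x" if "q \<in> C" for q x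
      unfolding u_def using that by (intro cINF_lower bdd_belowI2) auto
    have le_u: "m \<le> u x" if "\<And>q. q \<in> C \<Longrightarrow> m \<le> q x" for m x
      unfolding u_def using that False by (intro cINF_greatest) auto
    have "sublinear u"
      unfolding sublinear_def
    proof (intro conjI allI impI)
      fix x y
      have "u (x + y) \<le> q x + r y" if q: "q \<in> C" and r: "r \<in> C" for q r
      proof -
        \<comment> \<open>The infima at x and y may be approached along different members of the
          chain; the smaller of two members serves both.\<close>
        obtain s where s: "s \<in> C" "s x \<le> q x" "s y \<le> r y"
          using chain[OF q r] q r unfolding R_def by blast
        have "u (x + y) \<le> s (x + y)" by (rule u_le[OF s(1)])
        also have "\<dots> \<le> s x + s y"
          using s(1) CA unfolding A_def sublinear_def by blast
        finally show ?thesis using s by linarith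
      qed
      note le = this
      have "u (x + y) - q x \<le> u y" if "q \<in> C" for q
      proof (rule le_u)
        fix r assume "r \<in> C"
        from le[OF that this] show "u (x + y) - q x \<le> r y" by linarith
      qed
      note le = this
      have "u (x + y) - u y \<le> u x"
      proof (rule le_u)
        fix q assume "q \<in> C"
        from le[OF this] show "u (x + y) - u y \<le> q x" by linarith
      qed
      then show "u (x + y) \<le> u x + u y" by simp
    next
      fix c :: real and x assume c: "c > 0"
      have "u (c *\<^sub>R x) / c \<le> q x" if q: "q \<in> C" for q
      proof -
        have "sublinear q" using q CA by (auto simp: A_def)
        then have "u (c *\<^sub>R x) \<le> c * q x"
          using u_le[OF q, of "c *\<^sub>R x"] sublinear_scale[of q c x] c by simp
        then show ?thesis using c by (simp add: field_simps)
      qed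
      then have "u (c *\<^sub>R x) / c \<le> u x" by (rule le_u)
      then show "u (c *\<^sub>R x) \<le> c * u x" using c by (simp add: field_simps)
    qed
    moreover have "u x \<le> p x" for x
    proof -
      obtain q where q: "q \<in> C" using False by blast
      then have "q x \<le> p x" using CA by (auto simp: A_def)
      with u_le[OF q, of x] show ?thesis by linarith
    qed
    ultimately have "u \<in> A" by (simp add: A_def)
    then show ?thesis using u_le by (auto simp: R_def)
  qed
  ultimately obtain q where q: "q \<in> A" and min: "\<And>a. a \<in> A \<Longrightarrow> R q a \<Longrightarrow> a = q"
    using predicate_Zorn[of A R] by blast
  have sq: "sublinear q" and qp: "\<And>x. q x \<le> p x" using q by (auto simp: A_def)
  have odd: "q (- z) = - q z" for z
  proof -
    have le: "sublinear_shift q z x \<le> q x" for x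
      using sublinear_shift_le[OF sq, of 0 z x] by simp
    have "sublinear_shift q z \<in> A"
      using sublinear_sublinear_shift[OF sq, of z] le qp by (auto simp: A_def intro: order_trans)
    then have "sublinear_shift q z = q"
      by (rule min) (use le in \<open>simp add: R_def\<close>)
    then have "q (- z) \<le> q (- z + 1 *\<^sub>R z) - 1 * q z"
      using sublinear_shift_le[OF sq, of 1 z "- z"] by simp
    then show ?thesis
      using sublinear_neg[OF sq, of z] sublinear_zero[OF sq] by simp
  qed
  have "linear q"
  proof (rule linearI)
    fix x y
    have "q (x + y) \<le> q x + q y" "q ((x + y) + - y) \<le> q (x + y) + q (- y)"
      using sq unfolding sublinear_def by blast+
    then show "q (x + y) = q x + q y" by (simp add: odd)
  next
    fix c :: real and x
    show "q (c *\<^sub>R x) = c *\<^sub>R q x"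
    proof (cases c "0 :: real" rule: linorder_cases)
      case less
      then have "q ((- c) *\<^sub>R x) = - c * q x" by (intro sublinear_scale[OF sq]) simp
      then show ?thesis using odd[of "c *\<^sub>R x"] by simp
    next
      case equal
      then show ?thesis using sublinear_zero[OF sq] by simp
    next
      case greater
      then show ?thesis using sublinear_scale[OF sq greater] by simp
    qed
  qed
  then show thesis using that qp by blast
qed

text \<open>Dominating \<open>f\<close> by the shift of the norm along \<open>b\<close>, instead of
  by the norm itself, forces \<open>f (- b) \<le> - norm b\<close>. This takes the place of
  extending a functional from the line through \<open>b\<close>.\<close>

lemma bounded_functional_nonzero:
  fixes b :: "'w::real_normed_vector"
  assumes "b \<noteq> 0"
  obtains f :: "'w \<Rightarrow> real" where "bounded_linear f" "f b \<noteq> 0"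
proof -
  have n: "sublinear (norm :: 'w \<Rightarrow> real)"
    by (auto simp: sublinear_def norm_triangle_ineq)
  obtain f where f: "linear f" "\<And>x. f x \<le> sublinear_shift norm b x"
    using sublinear_dominates_linear[OF sublinear_sublinear_shift[OF n]] by blast
  have le: "f x \<le> norm x" for x
    using f(2)[of x] sublinear_shift_le[OF n, of 0 b x] by simp
  have "\<bar>f x\<bar> \<le> norm x" for x
    using le[of x] le[of "- x"] linear_neg[OF f(1), of x] by simp
  then have "bounded_linear f"
    using f(1) by (intro bounded_linear_intro[of f 1]) (auto simp: linear_add linear_scale)
  moreover have "f (- b) \<le> - norm b"
    using f(2)[of "- b"] sublinear_shift_le[OF n, of 1 b "- b"] by simp
  then have "f b \<noteq> 0"
    using assms linear_neg[OF f(1), of b] by auto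
  ultimately show thesis using that by blast
qed

text \<open>To add \<open>b\<close>, use \<open>c = b - Q b\<close>, which \<open>Q\<close>
  annihilates, and a bounded functional that is 1 at \<open>c\<close> and 0 on
  \<open>span B\<close>; subtracting \<open>Q x\<close> inside \<open>f0\<close> achieves the
  latter. The projection is thus a finite sum of bounded functionals times fixed vectors, so
  composing it with any linear map keeps it bounded.\<close>

lemma finite_dim_projection:
  fixes B :: "'w::real_normed_vector set"
  assumes "finite B"
  shows "\<exists>Q. is_projection_onto (span B) Q \<and> (\<forall>S::'w \<Rightarrow> 'w. linear S \<longrightarrow> bounded_linear (\<lambda>x. S (Q x)))"
  using assms
proof (induction B)
  case empty
  show ?case
    by (rule exI[of _ "\<lambda>_. 0"]) (auto simp: is_projection_onto_def linear_0)
next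
  case (insert b B)
  then obtain Q where Q: "bounded_linear Q" "range Q = span B" "\<And>v. v \<in> span B \<Longrightarrow> Q v = v"
    and SQ: "\<And>S::'w \<Rightarrow> 'w. linear S \<Longrightarrow> bounded_linear (\<lambda>x. S (Q x))"
    unfolding is_projection_onto_def by blast
  interpret Q: bounded_linear Q by fact
  show ?case
  proof (cases "b \<in> span B")
    case True
    then have "span (insert b B) = span B" by (rule span_redundant)
    then show ?thesis using insert by simp
  next
    case False
    define c where "c = b - Q b"
    have Qb: "Q b \<in> span B" using Q(2) by blast
    have "c \<noteq> 0"
      using False Qb by (auto simp: c_def)
    then obtain f0 :: "'w \<Rightarrow> real" where f0: "bounded_linear f0" "f0 c \<noteq> 0"
      using bounded_functional_nonzero[of c] by metis
    define f where "f x = f0 (x - Q x) / f0 c" for x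
    have f: "bounded_linear f"
      unfolding f_def
      by (rule bounded_linear_compose[OF bounded_linear_divide
          bounded_linear_compose[OF f0(1) bounded_linear_sub[OF bounded_linear_ident Q(1)]]])
    define Q' where "Q' x = Q x + f x *\<^sub>R c" for x
    have cs: "c \<in> span (insert b B)"
      unfolding c_def using Qb span_mono[of B "insert b B"] by (intro span_diff) (auto intro: span_base)
    have in_span: "Q' x \<in> span (insert b B)" for x
      unfolding Q'_def using Q(2) cs span_mono[of B "insert b B"] by (intro span_add span_scale) auto
    have fix_span: "Q' v = v" if v: "v \<in> span (insert b B)" for v
    proof -
      obtain k where k: "v - k *\<^sub>R b \<in> span B" using v by (auto simp: span_breakdown_eq)
      have "Q v - k *\<^sub>R Q b = v - k *\<^sub>R b"
        using Q(3)[OF k] by (simp add: Q.diff Q.scaleR)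
      then have eq: "v - Q v = k *\<^sub>R c" by (simp add: c_def algebra_simps)
      then have "f v = k"
        using f0 by (simp add: f_def linear_scale[OF bounded_linear.linear[OF f0(1)]])
      then show ?thesis using eq by (simp add: Q'_def algebra_simps)
    qed
    have "bounded_linear (\<lambda>x. S (Q' x))" if S: "linear S" for S :: "'w \<Rightarrow> 'w"
    proof -
      have "bounded_linear (\<lambda>x. S (Q x) + f x *\<^sub>R S c)"
        by (intro bounded_linear_add SQ[OF S] bounded_linear_compose[OF bounded_linear_scaleR_left f])
      then show ?thesis
        using S by (simp add: Q'_def linear_add linear_scale)
    qed
    moreover from this[OF linear_ident] have "bounded_linear Q'" by simp
    ultimately show ?thesis
      using in_span fix_span is_projection_ontoI by blast
  qed
qed

section \<open>The Peter--Weyl theorem\<close>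

text \<open>For \<open>d k = norm (A\<^sup>k v)\<^sup>2\<close> with a self-adjoint operator \<open>A\<close> the ratios increase, to \<open>l\<close> say;
  letting \<open>j\<close> tend to infinity in \<open>d (Suc n + j) / d j \<le> d n\<close> yields the lower bound.\<close>
lemma moment_sequence:
  fixes d :: "nat \<Rightarrow> real"
  assumes d0: "d 0 > 0" and d1: "d 1 > 0"
    and convex: "\<And>k. (d (Suc k))\<^sup>2 \<le> d k * d (Suc (Suc k))"
    and submult: "\<And>n j. d (Suc n + j) \<le> d n * d j"
  obtains l where "l > 0" "decseq (\<lambda>n. d n / l ^ n)" "\<And>n. l \<le> d n / l ^ n"
proof -
  have pos: "d k > 0 \<and> d (Suc k) > 0" for k
  proof (induction k)
    case 0
    then show ?case using d0 d1 by simp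
  next
    case (Suc k)
    then have "0 < (d (Suc k))\<^sup>2" by simp
    with convex[of k] have "0 < d k * d (Suc (Suc k))" by linarith
    with Suc show ?case by (simp add: zero_less_mult_iff)
  qed
  define r where "r k = d (Suc k) / d k" for k
  have r_pos: "r k > 0" for k using pos[of k] by (simp add: r_def)
  have "r k \<le> r (Suc k)" for k
    using convex[of k] pos[of k] pos[of "Suc k"] by (simp add: r_def divide_simps power2_eq_square mult.commute)
  then have inc: "incseq r" by (rule incseq_SucI)
  have "r k \<le> d 0" for k
    using submult[of 0 k] pos[of k] by (simp add: r_def divide_simps)
  then obtain l where l: "r \<longlonglongrightarrow> l" and r_le: "\<And>k. r k \<le> l"
    using incseq_convergent[OF inc] by blast
  have l_pos: "l > 0" using r_pos[of 0] r_le[of 0] by linarith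
  have "d (Suc n) / l ^ Suc n \<le> d n / l ^ n" for n
  proof -
    have "d (Suc n) \<le> l * d n" using r_le[of n] pos[of n] by (simp add: r_def divide_simps mult.commute)
    then have "d (Suc n) / l ^ Suc n \<le> l * d n / l ^ Suc n"
      using l_pos by (intro divide_right_mono) auto
    then show ?thesis using l_pos by simp
  qed
  then have dec: "decseq (\<lambda>n. d n / l ^ n)" by (rule decseq_SucI)
  have lim: "(\<lambda>j. d (n + j) / d j) \<longlonglongrightarrow> l ^ n" for n
  proof (induction n)
    case 0
    have "d (0 + j) / d j = 1" for j using pos[of j] by simp
    then show ?case by simp
  next
    case (Suc n)
    have "d (Suc n + j) / d j = r (j + n) * (d (n + j) / d j)" for j
      using pos[of "n + j"] by (simp add: r_def add.commute)
    moreover have "(\<lambda>j. r (j + n)) \<longlonglongrightarrow> l" using l by (rule LIMSEQ_ignore_initial_segment)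
    ultimately show ?case using tendsto_mult[OF _ Suc, of "\<lambda>j. r (j + n)" l] by (simp only: power_Suc)
  qed
  have "l \<le> d n / l ^ n" for n
  proof -
    have "d (Suc n + j) / d j \<le> d n" for j
      using submult[of n j] pos[of j] by (simp add: divide_simps)
    then have "l ^ Suc n \<le> d n"
      using LIMSEQ_le_const2[OF lim[of "Suc n"]] by blast
    then show ?thesis using l_pos by (simp add: divide_simps mult.commute)
  qed
  with l_pos dec show thesis using that by blast
qed

section \<open>The inner product given by the mean\<close>

context compact_topological_group
begin

definition ip :: "('g \<Rightarrow> real) \<Rightarrow> ('g \<Rightarrow> real) \<Rightarrow> real" where
  "ip f h = mean (\<lambda>x. f x * h x)"

definition ltrans :: "'g \<Rightarrow> ('g \<Rightarrow> 'b) \<Rightarrow> 'g \<Rightarrow> 'b" where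
  "ltrans k h = (\<lambda>x. h (inv k \<otimes> x))"

lemma cont_ltrans: "cont h \<Longrightarrow> k \<in> carrier G \<Longrightarrow> cont (ltrans k h)"
  unfolding ltrans_def by (rule cont_left) auto

lemma ip_cong:
  "(\<And>x. x \<in> carrier G \<Longrightarrow> f x = f' x) \<Longrightarrow> (\<And>x. x \<in> carrier G \<Longrightarrow> h x = h' x) \<Longrightarrow> ip f h = ip f' h'"
  unfolding ip_def by (rule mean_cong) simp

lemma ip_sym: "ip f h = ip h f"
  by (simp add: ip_def mult.commute)

lemma ip_diff: "cont f \<Longrightarrow> cont g \<Longrightarrow> cont h \<Longrightarrow> ip (\<lambda>x. f x - g x) h = ip f h - ip g h"
  unfolding ip_def by (simp add: left_diff_distrib mean_diff continuous_map_real_mult)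

lemma ip_cmult: "cont f \<Longrightarrow> cont h \<Longrightarrow> ip (\<lambda>x. c * f x) h = c * ip f h"
  unfolding ip_def by (simp add: mult.assoc mean_cmult continuous_map_real_mult)

lemma ip_sum:
  assumes "finite I" "\<And>i. i \<in> I \<Longrightarrow> cont (f i)" "cont h"
  shows "ip (\<lambda>x. \<Sum>i\<in>I. f i x) h = (\<Sum>i\<in>I. ip (f i) h)"
  unfolding ip_def sum_distrib_right using assms
  by (intro mean_sum) (auto intro: continuous_map_real_mult)

lemma ip_nonneg: "cont f \<Longrightarrow> ip f f \<ge> 0"
  unfolding ip_def by (rule mean_nonneg) (auto intro: continuous_map_real_mult)

lemma ip_pos: "cont f \<Longrightarrow> x \<in> carrier G \<Longrightarrow> f x \<noteq> 0 \<Longrightarrow> ip f f > 0"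
  unfolding ip_def
  by (rule mean_pos[of _ x]) (auto intro: continuous_map_real_mult simp: zero_less_mult_iff)

lemma ip_diff_diff:
  assumes "cont f" "cont g"
  shows "ip (\<lambda>x. f x - g x) (\<lambda>x. f x - g x) = ip f f - 2 * ip f g + ip g g"
proof -
  have c: "cont (\<lambda>x. f x - g x)" using assms by (rule continuous_map_diff)
  have "ip f (\<lambda>x. f x - g x) = ip f f - ip f g"
    using ip_diff[OF assms assms(1)] ip_sym[of f "\<lambda>x. f x - g x"] ip_sym[of f g] by simp
  moreover have "ip g (\<lambda>x. f x - g x) = ip f g - ip g g"
    using ip_diff[OF assms assms(2)] ip_sym[of g "\<lambda>x. f x - g x"] by simp
  ultimately show ?thesis
    by (simp add: ip_diff[OF assms c])
qed

lemma ip_Cauchy_Schwarz: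
  assumes f: "cont f" and g: "cont g"
  shows "(ip f g)\<^sup>2 \<le> ip f f * ip g g"
proof (cases "\<exists>x\<in>carrier G. g x \<noteq> 0")
  case True
  then have pos: "ip g g > 0" using ip_pos[OF g] by blast
  define c where "c = ip f g / ip g g"
  have cg: "cont (\<lambda>x. c * g x)" using g by (rule continuous_map_real_mult_left)
  have "0 \<le> ip (\<lambda>x. f x - c * g x) (\<lambda>x. f x - c * g x)"
    using f cg by (intro ip_nonneg continuous_map_diff)
  also have "\<dots> = ip f f - 2 * ip f (\<lambda>x. c * g x) + ip (\<lambda>x. c * g x) (\<lambda>x. c * g x)"
    by (rule ip_diff_diff[OF f cg])
  also have "\<dots> = ip f f - 2 * (c * ip f g) + c * (c * ip g g)"
    using ip_cmult[OF g f, of c] ip_cmult[OF g cg, of c] ip_cmult[OF g g, of c]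
      ip_sym[of f "\<lambda>x. c * g x"] ip_sym[of g "\<lambda>x. c * g x"] ip_sym[of g f] by simp
  also have "\<dots> = ip f f - (ip f g)\<^sup>2 / ip g g"
    using pos by (simp add: c_def power2_eq_square field_simps)
  finally show ?thesis using pos by (simp add: field_simps)
next
  case False
  then have "ip f g = ip f (\<lambda>_. 0)" by (intro ip_cong) auto
  then show ?thesis
    using ip_nonneg[OF f] ip_nonneg[OF g] by (simp add: ip_def)
qed

lemma ip_Bessel:
  fixes e :: "nat \<Rightarrow> 'g \<Rightarrow> real"
  assumes f: "cont f" and e: "\<And>i. i < n \<Longrightarrow> cont (e i)"
    and on: "\<And>i j. i < n \<Longrightarrow> j < n \<Longrightarrow> ip (e i) (e j) = (if i = j then 1 else 0)"
  shows "j < n \<Longrightarrow> ip (\<lambda>x. f x - (\<Sum>i<n. ip f (e i) * e i x)) (e j) = 0"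
    "(\<Sum>i<n. (ip f (e i))\<^sup>2) \<le> ip f f"
proof -
  let ?s = "\<lambda>x. \<Sum>i<n. ip f (e i) * e i x"
  have c: "cont (\<lambda>x. ip f (e i) * e i x)" if "i < n" for i
    using e[OF that] by (rule continuous_map_real_mult_left)
  then have s: "cont ?s" by (intro continuous_map_sum) auto
  have se: "ip ?s h = (\<Sum>i<n. ip f (e i) * ip (e i) h)" if "cont h" for h
  proof -
    have "ip ?s h = (\<Sum>i<n. ip (\<lambda>x. ip f (e i) * e i x) h)"
      using c that by (intro ip_sum) auto
    also have "\<dots> = (\<Sum>i<n. ip f (e i) * ip (e i) h)"
      using e that by (intro sum.cong refl ip_cmult) auto
    finally show ?thesis .
  qed
  have sej: "ip ?s (e j) = ip f (e j)" if "j < n" for j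
    using se[OF e[OF that]] on that by (simp add: sum.delta if_distrib cong: if_cong)
  show "ip (\<lambda>x. f x - ?s x) (e j) = 0" if "j < n"
    using that sej[of j] ip_diff[OF f s e[of j]] by simp
  have "ip ?s ?s = (\<Sum>i<n. (ip f (e i))\<^sup>2)"
    unfolding se[OF s] by (intro sum.cong refl) (simp add: sej ip_sym[of "e _" ?s] power2_eq_square)
  moreover have "ip f ?s = (\<Sum>i<n. (ip f (e i))\<^sup>2)"
    unfolding ip_sym[of f ?s] se[OF f] by (intro sum.cong refl) (simp add: ip_sym[of "e _" f] power2_eq_square)
  moreover have "0 \<le> ip (\<lambda>x. f x - ?s x) (\<lambda>x. f x - ?s x)"
    using f s by (intro ip_nonneg continuous_map_diff)
  ultimately show "(\<Sum>i<n. (ip f (e i))\<^sup>2) \<le> ip f f"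
    using ip_diff_diff[OF f s] by simp
qed

lemma ip_ltrans:
  assumes "cont f" "cont h" "k \<in> carrier G"
  shows "ip (ltrans k f) (ltrans k h) = ip f h"
  unfolding ip_def ltrans_def
  using mean_left[of "\<lambda>x. f x * h x" "inv k"] assms by (simp add: continuous_map_real_mult)

lemma ip_le_sup:
  assumes f: "cont f" and C: "\<And>x. x \<in> carrier G \<Longrightarrow> (f x)\<^sup>2 \<le> C"
  shows "ip f f \<le> C"
proof -
  have "mean (\<lambda>x. f x * f x) \<le> mean (\<lambda>_. C)"
    using f C by (intro mean_mono continuous_map_real_mult) (auto simp: power2_eq_square)
  then show ?thesis by (simp add: ip_def)
qed

end

section \<open>Convolution with a symmetric kernel\<close>

locale symmetric_kernel = compact_topological_group G T
  for G :: "('g, 'z) monoid_scheme" (structure) and T :: "'g topology" +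
  fixes \<phi> :: "'g \<Rightarrow> real"
  assumes cont_\<phi>: "cont \<phi>"
    and \<phi>_inv: "\<And>x. x \<in> carrier G \<Longrightarrow> \<phi> (inv x) = \<phi> x"
begin

text \<open>The integral operator with kernel \<open>\<phi> (inv x \<otimes> y)\<close>. The kernel
  is symmetric by \<open>\<phi>_inv\<close>, and the operator commutes with left translations
  because only \<open>inv x \<otimes> y\<close> enters.\<close>

definition K :: "('g \<Rightarrow> real) \<Rightarrow> 'g \<Rightarrow> real" where
  "K h x = mean (\<lambda>y. \<phi> (inv x \<otimes> y) * h y)"

lemma K_eq_ip: "K h x = ip (ltrans x \<phi>) h"
  by (simp add: K_def ip_def ltrans_def)

lemma continuous_kernel:
  assumes "cont h"
  shows "continuous_map (prod_topology T T) euclidean (\<lambda>(y, x). \<phi> (inv x \<otimes> y) * h y)"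
  unfolding case_prod_unfold
  by (intro continuous_map_real_mult continuous_comp[OF cont_\<phi>] continuous_comp[OF assms]
      continuous_mult' continuous_inv' continuous_map_fst continuous_map_snd)

lemma cont_K: "cont h \<Longrightarrow> cont (K h)"
  unfolding K_def by (rule continuous_map_mean_parameter[OF compact continuous_kernel])

lemma K_cong: "(\<And>x. x \<in> carrier G \<Longrightarrow> h x = h' x) \<Longrightarrow> K h = K h'"
  unfolding K_def by (intro ext mean_cong) simp

lemma K_diff: "cont h \<Longrightarrow> cont h' \<Longrightarrow> x \<in> carrier G \<Longrightarrow> K (\<lambda>x. h x - h' x) x = K h x - K h' x"
  unfolding K_eq_ip ip_sym[of "ltrans x \<phi>"] by (intro ip_diff cont_ltrans cont_\<phi>)

lemma K_cmult: "cont h \<Longrightarrow> x \<in> carrier G \<Longrightarrow> K (\<lambda>x. c * h x) x = c * K h x"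
  unfolding K_eq_ip ip_sym[of "ltrans x \<phi>"] by (intro ip_cmult cont_ltrans cont_\<phi>)

lemma K_symmetric:
  assumes h: "cont h" and g: "cont g"
  shows "ip (K h) g = ip h (K g)"
proof -
  have c: "continuous_map (prod_topology T T) euclidean (\<lambda>(y, x). \<phi> (inv x \<otimes> y) * h y * g x)"
    using continuous_map_real_mult[OF continuous_kernel[OF h] continuous_comp[OF g continuous_map_snd]]
    by (simp add: case_prod_unfold)
  have "ip (K h) g = mean (\<lambda>x. mean (\<lambda>y. \<phi> (inv x \<otimes> y) * h y * g x))"
    unfolding ip_def K_def
  proof (rule mean_cong)
    fix x assume x: "x \<in> carrier G"
    have "cont (\<lambda>y. \<phi> (inv x \<otimes> y) * h y)"
      using x h by (intro continuous_map_real_mult cont_left[OF cont_\<phi>]) auto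
    from mean_cmult[OF this, of "g x"]
    show "mean (\<lambda>y. \<phi> (inv x \<otimes> y) * h y) * g x = mean (\<lambda>y. \<phi> (inv x \<otimes> y) * h y * g x)"
      by (simp add: mult.commute)
  qed
  also have "\<dots> = mean (\<lambda>y. mean (\<lambda>x. \<phi> (inv x \<otimes> y) * h y * g x))"
    by (rule mean_swap[OF c, symmetric])
  also have "\<dots> = mean (\<lambda>y. h y * mean (\<lambda>x. \<phi> (inv y \<otimes> x) * g x))"
  proof (rule mean_cong)
    fix y assume y: "y \<in> carrier G"
    have "cont (\<lambda>x. \<phi> (inv y \<otimes> x) * g x)"
      using y g by (intro continuous_map_real_mult cont_left[OF cont_\<phi>]) auto
    then have "h y * mean (\<lambda>x. \<phi> (inv y \<otimes> x) * g x) = mean (\<lambda>x. h y * (\<phi> (inv y \<otimes> x) * g x))"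
      by (rule mean_cmult[symmetric])
    also have "\<dots> = mean (\<lambda>x. \<phi> (inv x \<otimes> y) * h y * g x)"
    proof (rule mean_cong)
      fix x assume x: "x \<in> carrier G"
      have "\<phi> (inv x \<otimes> y) = \<phi> (inv y \<otimes> x)"
        using \<phi>_inv[of "inv x \<otimes> y"] x y by (simp add: inv_mult_group)
      then show "h y * (\<phi> (inv y \<otimes> x) * g x) = \<phi> (inv x \<otimes> y) * h y * g x" by simp
    qed
    finally show "mean (\<lambda>x. \<phi> (inv x \<otimes> y) * h y * g x) = h y * mean (\<lambda>x. \<phi> (inv y \<otimes> x) * g x)" ..
  qed
  finally show ?thesis by (simp add: ip_def K_def)
qed

lemma K_ltrans:
  assumes h: "cont h" and k: "k \<in> carrier G" and x: "x \<in> carrier G"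
  shows "K (ltrans k h) x = ltrans k (K h) x"
proof -
  have "cont (\<lambda>y. \<phi> (inv x \<otimes> y) * h (inv k \<otimes> y))"
    using h k x by (intro continuous_map_real_mult cont_left cont_\<phi>) auto
  from mean_left[OF this k]
  have "K (ltrans k h) x = mean (\<lambda>y. \<phi> (inv x \<otimes> (k \<otimes> y)) * h (inv k \<otimes> (k \<otimes> y)))"
    by (simp add: K_def ltrans_def)
  also have "\<dots> = mean (\<lambda>y. \<phi> (inv (inv k \<otimes> x) \<otimes> y) * h y)"
    using k x by (intro mean_cong) (simp add: inv_mult_group m_assoc inv_solve_left' flip: m_assoc[of "inv k" k])
  finally show ?thesis by (simp add: K_def ltrans_def)
qed

lemma cont_K_pow: "cont h \<Longrightarrow> cont ((K ^^ n) h)"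
  by (induction n) (auto intro: cont_K)

lemma K_pow_symmetric: "cont h \<Longrightarrow> cont g \<Longrightarrow> ip ((K ^^ n) h) g = ip h ((K ^^ n) g)"
proof (induction n arbitrary: h)
  case (Suc n)
  have "ip ((K ^^ Suc n) h) g = ip (K h) ((K ^^ n) g)"
    using Suc cont_K by (simp add: funpow_swap1)
  also have "\<dots> = ip h ((K ^^ Suc n) g)"
    using K_symmetric[OF Suc.prems(1) cont_K_pow[OF Suc.prems(2)]] by simp
  finally show ?case .
qed simp

lemma K_pow_ltrans:
  assumes h: "cont h" and k: "k \<in> carrier G" and x: "x \<in> carrier G"
  shows "(K ^^ n) (ltrans k h) x = ltrans k ((K ^^ n) h) x"
  using x
proof (induction n arbitrary: x)
  case (Suc n)
  have "(K ^^ Suc n) (ltrans k h) x = K (ltrans k ((K ^^ n) h)) x"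
    using K_cong[of "(K ^^ n) (ltrans k h)" "ltrans k ((K ^^ n) h)"] Suc by simp
  also have "\<dots> = ltrans k ((K ^^ Suc n) h) x"
    using K_ltrans[OF cont_K_pow[OF h] k] Suc by simp
  finally show ?case .
qed simp

text \<open>Identifies the kernel of a power of the operator. By symmetry \<open>K ^^ n\<close>
  moves to the other side of the inner product, where it commutes with the translation.\<close>

lemma K_pow_eq_ip:
  assumes h: "cont h" and x: "x \<in> carrier G"
  shows "(K ^^ Suc n) h x = ip (ltrans x ((K ^^ n) \<phi>)) h"
proof -
  have "(K ^^ Suc n) h x = ip (ltrans x \<phi>) ((K ^^ n) h)"
    by (simp add: K_eq_ip)
  also have "\<dots> = ip ((K ^^ n) (ltrans x \<phi>)) h"
    using h x by (intro K_pow_symmetric[symmetric] cont_ltrans cont_\<phi>)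
  also have "\<dots> = ip (ltrans x ((K ^^ n) \<phi>)) h"
    using x by (intro ip_cong K_pow_ltrans cont_\<phi>) auto
  finally show ?thesis .
qed

text \<open>By \<open>K_pow_eq_ip\<close> this is the squared Hilbert--Schmidt norm of
  \<open>K ^^ Suc n\<close>.\<close>

definition d :: "nat \<Rightarrow> real" where
  "d n = ip ((K ^^ n) \<phi>) ((K ^^ n) \<phi>)"

text \<open>Cauchy--Schwarz for \<open>K_pow_eq_ip\<close>, with the norm invariant under
  translation. The left side is a pointwise value, so mean-square convergence becomes uniform
  convergence after one application of \<open>K\<close>.\<close>

lemma K_pow_bound:
  assumes h: "cont h" and x: "x \<in> carrier G"
  shows "((K ^^ Suc n) h x)\<^sup>2 \<le> d n * ip h h"
proof -
  have c: "cont ((K ^^ n) \<phi>)" by (rule cont_K_pow[OF cont_\<phi>])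
  show ?thesis
    using ip_Cauchy_Schwarz[OF cont_ltrans[OF c x] h] ip_ltrans[OF c c x]
    by (simp add: K_pow_eq_ip[OF h x] d_def del: funpow.simps)
qed

lemma d_add: "ip ((K ^^ n) \<phi>) ((K ^^ m) \<phi>) = d k" if "n + m = 2 * k"
proof -
  have *: "ip ((K ^^ n) \<phi>) ((K ^^ m) \<phi>) = ip \<phi> ((K ^^ (n + m)) \<phi>)" for n m
    using K_pow_symmetric[OF cont_\<phi> cont_K_pow[OF cont_\<phi>]] by (simp add: funpow_add)
  show ?thesis
    unfolding d_def * using that by (simp add: mult_2)
qed

text \<open>Even iterates are used because their inner products are values of \<open>d\<close> and
  because they see only the square of \<open>K\<close>. Convergence of \<open>a\<close> makes
  \<open>v\<close> a Cauchy sequence in mean square; continuous functions need not be complete in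
  that norm, so \<open>K\<close> is applied once more, and \<open>s\<close> converges uniformly to a
  continuous \<open>u\<close>.\<close>

lemma eigenfunction:
  assumes "x0 \<in> carrier G" "\<phi> x0 \<noteq> 0"
  obtains l u where "l > 0" "cont u" "\<And>x. x \<in> carrier G \<Longrightarrow> K (K u) x = l * u x"
    "\<exists>x\<in>carrier G. u x \<noteq> 0"
proof -
  have c: "cont ((K ^^ n) \<phi>)" for n by (rule cont_K_pow[OF cont_\<phi>])
  have d0: "d 0 > 0" using ip_pos[OF cont_\<phi> assms] by (simp add: d_def)
  \<comment> \<open>At the identity the kernel function is paired with itself, so
    \<open>K \<phi>\<close> does not vanish there.\<close>
  have "K \<phi> \<one> = d 0"
    unfolding K_def d_def ip_def by (simp, intro mean_cong) simp
  then have d1: "d 1 > 0"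
    using ip_pos[OF cont_K[OF cont_\<phi>] one_closed] d0 by (simp add: d_def)
  have "(d (Suc k))\<^sup>2 \<le> d k * d (Suc (Suc k))" for k
    using ip_Cauchy_Schwarz[OF c[of k] c[of "Suc (Suc k)"]] d_add[of k "Suc (Suc k)" "Suc k"]
    by (simp add: d_def del: funpow.simps)
  \<comment> \<open>A pointwise bound is also a mean-square bound because the constant 1 has mean 1;
    this compares the operator norm with the Hilbert--Schmidt norm.\<close>
  moreover have "d (Suc n + j) \<le> d n * d j" for n j
  proof -
    have "(K ^^ (Suc n + j)) \<phi> = (K ^^ Suc n) ((K ^^ j) \<phi>)" by (simp only: funpow_add comp_apply)
    moreover have "ip ((K ^^ Suc n) ((K ^^ j) \<phi>)) ((K ^^ Suc n) ((K ^^ j) \<phi>)) \<le> d n * ip ((K ^^ j) \<phi>) ((K ^^ j) \<phi>)"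
      using K_pow_bound[OF c] by (intro ip_le_sup cont_K_pow c)
    ultimately show ?thesis by (simp add: d_def del: funpow.simps)
  qed
  ultimately obtain l where l: "l > 0" "decseq (\<lambda>n. d n / l ^ n)" "\<And>n. l \<le> d n / l ^ n"
    using moment_sequence[OF d0 d1] by blast
  define a where "a n = d n / l ^ n" for n
  define v where "v n = (\<lambda>x. (1 / l ^ n) * (K ^^ (2 * n)) \<phi> x)" for n
  define s where "s n = K (v n)" for n
  have cv: "cont (v n)" for n unfolding v_def by (rule continuous_map_real_mult_left[OF c])
  have cs: "cont (s n)" for n unfolding s_def by (rule cont_K[OF cv])
  have ipv: "ip (v n) (v m) = a (n + m)" for n m
  proof -
    have "ip (v n) (v m) = (1 / l ^ n) * ((1 / l ^ m) * ip ((K ^^ (2 * n)) \<phi>) ((K ^^ (2 * m)) \<phi>))"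
      unfolding v_def[of n] ip_cmult[OF c cv] unfolding v_def ip_sym[of "(K ^^ (2 * n)) \<phi>"] ip_cmult[OF c c] ..
    then show ?thesis
      by (simp add: a_def power_add d_add[of "2 * n" "2 * m" "n + m"])
  qed
  have KKv: "K (K (v n)) x = l * v (Suc n) x" if x: "x \<in> carrier G" for n x
  proof -
    have "K (v n) y = (1 / l ^ n) * K ((K ^^ (2 * n)) \<phi>) y" if "y \<in> carrier G" for y
      unfolding v_def by (rule K_cmult[OF c that])
    then have "K (K (v n)) = K (\<lambda>y. (1 / l ^ n) * (K ^^ (Suc (2 * n))) \<phi> y)"
      by (intro K_cong) simp
    then have "K (K (v n)) x = (1 / l ^ n) * (K ^^ (Suc (Suc (2 * n)))) \<phi> x"
      using K_cmult[OF c x, of "1 / l ^ n" "Suc (2 * n)"] by simp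
    then show ?thesis using l(1) by (simp add: v_def)
  qed
  have "convergent a"
    using decseq_convergent[of a l] l(2,3) unfolding a_def convergent_def by blast
  then obtain L where L: "a \<longlonglongrightarrow> L" unfolding convergent_def by blast
  have Ks: "(s n x - s m x)\<^sup>2 \<le> d 0 * (a (n + n) - 2 * a (n + m) + a (m + m))"
    if x: "x \<in> carrier G" for n m x
    using K_pow_bound[OF continuous_map_diff[OF cv[of n] cv[of m]] x, of 0]
    by (simp add: s_def K_diff[OF cv cv x] ip_diff_diff[OF cv cv] ipv)
  have small: "\<exists>N. \<forall>n\<ge>N. \<forall>m\<ge>N. \<forall>x\<in>carrier G. \<bar>s n x - s m x\<bar> < e" if e: "e > 0" for e
  proof -
    \<comment> \<open>Four values of \<open>a\<close>, counted with multiplicity, enter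
      \<open>Ks\<close>. Their coefficients add up to zero, so \<open>L\<close> cancels and each
      contributes less than \<open>\<eta>\<close>.\<close>
    define \<eta> where "\<eta> = e\<^sup>2 / (4 * d 0)"
    have "\<eta> > 0" using e d0 by (simp add: \<eta>_def)
    then obtain N where N: "\<And>k. k \<ge> N \<Longrightarrow> \<bar>a k - L\<bar> < \<eta>"
      using LIMSEQ_D[OF L, of \<eta>] by auto
    have "\<bar>s n x - s m x\<bar> < e" if nm: "n \<ge> N" "m \<ge> N" and x: "x \<in> carrier G" for n m x
    proof -
      have "a (n + n) - 2 * a (n + m) + a (m + m) < 4 * \<eta>"
        using N[of "n + n"] N[of "n + m"] N[of "m + m"] nm by (simp add: abs_less_iff)
      then have "(s n x - s m x)\<^sup>2 < d 0 * (4 * \<eta>)"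
        using Ks[OF x, of n m] d0 by (meson le_less_trans mult_strict_left_mono)
      also have "\<dots> = e\<^sup>2" using d0 by (simp add: \<eta>_def)
      finally have "\<bar>s n x - s m x\<bar>\<^sup>2 < e\<^sup>2" by simp
      then show ?thesis by (rule power2_less_imp_less) (use e in simp)
    qed
    then show ?thesis by blast
  qed
  define u where "u x = lim (\<lambda>n. s n x)" for x
  have u: "(\<lambda>n. s n x) \<longlonglongrightarrow> u x" if x: "x \<in> carrier G" for x
  proof -
    have "Cauchy (\<lambda>n. s n x)"
      using small x unfolding Cauchy_iff by (metis real_norm_def)
    then show ?thesis
      unfolding u_def using Cauchy_convergent_iff convergent_LIMSEQ_iff by blast
  qed
  have unif: "\<exists>N. \<forall>n\<ge>N. \<forall>x\<in>carrier G. \<bar>s n x - u x\<bar> \<le> e" if e: "e > 0" for e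
  proof -
    obtain N where N: "\<forall>n\<ge>N. \<forall>m\<ge>N. \<forall>x\<in>carrier G. \<bar>s n x - s m x\<bar> < e"
      using small[OF e] by blast
    have "\<bar>s n x - u x\<bar> \<le> e" if n: "n \<ge> N" and x: "x \<in> carrier G" for n x
    proof (rule LIMSEQ_le_const2)
      show "(\<lambda>m. \<bar>s n x - s m x\<bar>) \<longlonglongrightarrow> \<bar>s n x - u x\<bar>"
        by (intro tendsto_intros u x)
      show "\<exists>M. \<forall>m\<ge>M. \<bar>s n x - s m x\<bar> \<le> e"
        using N n x by (intro exI[of _ N]) (auto intro: less_imp_le)
    qed
    then show ?thesis by blast
  qed
  have cu: "cont u"
    unfolding continuous_map_euclidean_dist
  proof (intro ballI allI impI)
    fix x and e :: real assume x: "x \<in> topspace T" and "e > 0"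
    then have e: "e / 3 > 0" by simp
    obtain N where N: "\<And>x. x \<in> carrier G \<Longrightarrow> \<bar>s N x - u x\<bar> \<le> e / 3"
      using unif[OF e] by blast
    obtain V where V: "openin T V" "x \<in> V" "\<And>y. y \<in> V \<Longrightarrow> dist (s N y) (s N x) < e / 3"
      using cs[of N, unfolded continuous_map_euclidean_dist, rule_format, OF x e] by blast
    have "dist (u y) (u x) < e" if y: "y \<in> V" for y
    proof -
      have y': "y \<in> carrier G" and x': "x \<in> carrier G" using V(1) y x openin_subset topspace_eq by blast+
      show ?thesis
        using N[OF y'] N[OF x'] V(3)[OF y] unfolding dist_real_def by linarith
    qed
    then show "\<exists>V. openin T V \<and> x \<in> V \<and> (\<forall>y\<in>V. dist (u y) (u x) < e)"
      using V by blast
  qed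
  have csu: "cont (\<lambda>x. s n x - u x)" for n by (rule continuous_map_diff[OF cs cu])
  have ip0: "(\<lambda>n. ip (\<lambda>x. s n x - u x) (\<lambda>x. s n x - u x)) \<longlonglongrightarrow> 0"
  proof (rule LIMSEQ_I)
    fix e :: real assume e: "e > 0"
    then have "sqrt (e / 2) > 0" by simp
    then obtain N where N: "\<forall>n\<ge>N. \<forall>x\<in>carrier G. \<bar>s n x - u x\<bar> \<le> sqrt (e / 2)"
      using unif by blast
    have "norm (ip (\<lambda>x. s n x - u x) (\<lambda>x. s n x - u x) - 0) < e" if n: "n \<ge> N" for n
    proof -
      have "(s n x - u x)\<^sup>2 \<le> e / 2" if "x \<in> carrier G" for x
      proof -
        have "\<bar>s n x - u x\<bar>\<^sup>2 \<le> (sqrt (e / 2))\<^sup>2"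
          using N n that by (intro power_mono) auto
        then show ?thesis using e by simp
      qed
      then have "ip (\<lambda>x. s n x - u x) (\<lambda>x. s n x - u x) \<le> e / 2"
        by (intro ip_le_sup csu)
      then show ?thesis using ip_nonneg[OF csu[of n]] e by simp
    qed
    then show "\<exists>N. \<forall>n\<ge>N. norm (ip (\<lambda>x. s n x - u x) (\<lambda>x. s n x - u x) - 0) < e" by blast
  qed
  have ev: "K (K u) x = l * u x" if x: "x \<in> carrier G" for x
  proof -
    \<comment> \<open>\<open>K_pow_bound\<close> at index 1 bounds the squared operator pointwise by
      the mean square, so the limit passes through it.\<close>
    have "(\<lambda>n. (K (K (s n)) x - K (K u) x)\<^sup>2) \<longlonglongrightarrow> 0"
    proof (rule tendsto_sandwich[of "\<lambda>_. 0"])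
      have "K (\<lambda>x. s n x - u x) y = K (s n) y - K u y" if "y \<in> carrier G" for n y
        by (rule K_diff[OF cs cu that])
      then have "K (K (\<lambda>x. s n x - u x)) = K (\<lambda>y. K (s n) y - K u y)" for n
        by (rule K_cong)
      then have "K (K (\<lambda>x. s n x - u x)) x = K (K (s n)) x - K (K u) x" for n
        by (simp add: K_diff[OF cont_K[OF cs] cont_K[OF cu] x])
      then show "\<forall>\<^sub>F n in sequentially. (K (K (s n)) x - K (K u) x)\<^sup>2 \<le> d 1 * ip (\<lambda>x. s n x - u x) (\<lambda>x. s n x - u x)"
        using K_pow_bound[OF csu x, of 1] by (intro always_eventually) simp
      show "(\<lambda>n. d 1 * ip (\<lambda>x. s n x - u x) (\<lambda>x. s n x - u x)) \<longlonglongrightarrow> 0"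
        using tendsto_mult_left[OF ip0, of "d 1"] by simp
    qed auto
    from tendsto_real_sqrt[OF this] have "(\<lambda>n. K (K (s n)) x - K (K u) x) \<longlonglongrightarrow> 0"
      by (simp add: tendsto_rabs_zero_iff)
    then have lim1: "(\<lambda>n. K (K (s n)) x) \<longlonglongrightarrow> K (K u) x"
      by (simp add: LIM_zero_iff)
    have "K (K (s n)) x = l * s (Suc n) x" for n
    proof -
      have "K (K (s n)) = K (\<lambda>x. l * v (Suc n) x)"
        unfolding s_def by (rule K_cong) (rule KKv)
      then show ?thesis by (simp add: K_cmult[OF cv x] s_def)
    qed
    then have "(\<lambda>n. l * s (Suc n) x) \<longlonglongrightarrow> K (K u) x" using lim1 by simp
    moreover have "(\<lambda>n. l * s (Suc n) x) \<longlonglongrightarrow> l * u x"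
      using LIMSEQ_Suc[OF u[OF x]] by (rule tendsto_mult_left)
    ultimately show ?thesis by (rule LIMSEQ_unique)
  qed
  have "\<exists>x\<in>carrier G. u x \<noteq> 0"
  proof (rule ccontr)
    assume "\<not> ?thesis"
    then have z: "u x = 0" if "x \<in> carrier G" for x using that by blast
    \<comment> \<open>The squared norm equals \<open>l * a (n + Suc n)\<close>, and \<open>a\<close>
      never falls below \<open>l\<close>; hence the limit of \<open>s\<close> cannot be
      zero.\<close>
    have "ip (s n) (s n) \<ge> l * l" for n
    proof -
      have "ip (s n) (s n) = ip (v n) (K (K (v n)))"
        unfolding s_def by (rule K_symmetric[OF cv cont_K[OF cv]])
      also have "\<dots> = ip (v n) (\<lambda>x. l * v (Suc n) x)"
        by (rule ip_cong) (auto simp: KKv)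
      also have "\<dots> = l * a (n + Suc n)"
        using ip_cmult[OF cv cv, of l "Suc n" n] by (simp add: ip_sym[of "v n" "\<lambda>x. l * v (Suc n) x"] ipv add.commute)
      finally show ?thesis
        using mult_left_mono[OF l(3)[of "n + Suc n"], of l] l(1) by (simp only: a_def less_imp_le)
    qed
    moreover have "ip (s n) (s n) = ip (\<lambda>x. s n x - u x) (\<lambda>x. s n x - u x)" for n
      by (rule ip_cong) (auto simp: z)
    ultimately have "l * l \<le> 0"
      using LIMSEQ_le_const[OF ip0, of "l * l"] by auto
    then show False using l(1) by (simp add: mult_le_0_iff)
  qed
  then show thesis using that l(1) cu ev by blast
qed

section \<open>Finite dimension of the eigenspaces of the squared operator\<close>

definition eigenspace :: "real \<Rightarrow> ('g \<Rightarrow> real) set" where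
  "eigenspace l = {h. cont h \<and> (\<forall>x\<in>carrier G. K (K h) x = l * h x)}"

lemma eigenspace_ltrans:
  assumes h: "h \<in> eigenspace l" and k: "k \<in> carrier G"
  shows "ltrans k h \<in> eigenspace l"
proof -
  have c: "cont h" using h by (simp add: eigenspace_def)
  have "K (K (ltrans k h)) x = l * ltrans k h x" if x: "x \<in> carrier G" for x
    using K_pow_ltrans[OF c k x, of 2] h k x by (simp add: eigenspace_def ltrans_def numeral_2_eq_2)
  then show ?thesis using cont_ltrans[OF c k] by (simp add: eigenspace_def)
qed

lemma eigenspace_cmult:
  assumes h: "h \<in> eigenspace l"
  shows "(\<lambda>x. c * h x) \<in> eigenspace l"
proof -
  have ch: "cont h" using h by (simp add: eigenspace_def)
  have "K (\<lambda>x. c * h x) x = c * K h x" if "x \<in> carrier G" for x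
    by (rule K_cmult[OF ch that])
  then have "K (K (\<lambda>x. c * h x)) = K (\<lambda>x. c * K h x)" by (rule K_cong)
  then show ?thesis
    using h by (auto simp: eigenspace_def K_cmult[OF cont_K[OF ch]] intro: continuous_map_real_mult_left)
qed

lemma eigenspace_diff:
  assumes h: "h \<in> eigenspace l" and g: "g \<in> eigenspace l"
  shows "(\<lambda>x. h x - g x) \<in> eigenspace l"
proof -
  have ch: "cont h" and cg: "cont g" using h g by (simp_all add: eigenspace_def)
  have "K (\<lambda>x. h x - g x) x = K h x - K g x" if "x \<in> carrier G" for x
    by (rule K_diff[OF ch cg that])
  then have "K (K (\<lambda>x. h x - g x)) = K (\<lambda>x. K h x - K g x)" by (rule K_cong)
  then show ?thesis
    using h g by (auto simp: eigenspace_def K_diff[OF cont_K[OF ch] cont_K[OF cg]] right_diff_distrib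
        intro: continuous_map_diff)
qed

lemma eigenspace_zero: "(\<lambda>_. 0) \<in> eigenspace l"
  by (simp add: eigenspace_def K_def)

lemma eigenspace_sum:
  fixes n :: nat
  assumes "\<And>i. i < n \<Longrightarrow> h i \<in> eigenspace l"
  shows "(\<lambda>x. \<Sum>i<n. h i x) \<in> eigenspace l"
  using assms
proof (induction n)
  case (Suc n)
  then have "(\<lambda>x. (\<Sum>i<n. h i x) - (- 1) * h n x) \<in> eigenspace l"
    by (intro eigenspace_diff eigenspace_cmult) auto
  then show ?case by simp
qed (simp add: eigenspace_zero)

text \<open>By Bessel's inequality \<open>(\<Sum>i<n. (l * e i x)\<^sup>2) \<le> d 1\<close> for every \<open>x\<close>; integrate over \<open>x\<close>.\<close>
lemma eigenspace_orthonormal_bound: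
  fixes e :: "nat \<Rightarrow> 'g \<Rightarrow> real"
  assumes l: "l > 0" and e: "\<And>i. i < n \<Longrightarrow> e i \<in> eigenspace l"
    and on: "\<And>i j. i < n \<Longrightarrow> j < n \<Longrightarrow> ip (e i) (e j) = (if i = j then 1 else 0)"
  shows "real n \<le> d 1 / l\<^sup>2"
proof -
  have c: "cont (e i)" if "i < n" for i using e[OF that] by (simp add: eigenspace_def)
  have c1: "cont ((K ^^ 1) \<phi>)" by (rule cont_K_pow[OF cont_\<phi>])
  have "(\<Sum>i<n. e i x * e i x) \<le> d 1 / l\<^sup>2" if x: "x \<in> carrier G" for x
  proof -
    have "ip (ltrans x ((K ^^ 1) \<phi>)) (e i) = l * e i x" if "i < n" for i
      using K_pow_eq_ip[OF c[OF that] x, of 1] e[OF that] x by (simp add: eigenspace_def)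
    then have "(\<Sum>i<n. (l * e i x)\<^sup>2) = (\<Sum>i<n. (ip (ltrans x ((K ^^ 1) \<phi>)) (e i))\<^sup>2)" by simp
    also have "\<dots> \<le> ip (ltrans x ((K ^^ 1) \<phi>)) (ltrans x ((K ^^ 1) \<phi>))"
      using c on by (intro ip_Bessel cont_ltrans[OF c1 x])
    also have "\<dots> = d 1" by (simp only: ip_ltrans[OF c1 c1 x] d_def)
    finally have "l\<^sup>2 * (\<Sum>i<n. e i x * e i x) \<le> d 1"
      by (simp add: power_mult_distrib sum_distrib_left power2_eq_square mult_ac)
    then show ?thesis using l by (simp add: field_simps)
  qed
  then have "mean (\<lambda>x. \<Sum>i<n. e i x * e i x) \<le> mean (\<lambda>_. d 1 / l\<^sup>2)"
    using c by (intro mean_mono continuous_map_sum continuous_map_real_mult) auto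
  moreover have "mean (\<lambda>x. \<Sum>i<n. e i x * e i x) = (\<Sum>i<n. ip (e i) (e i))"
    unfolding ip_def using c by (intro mean_sum continuous_map_real_mult) auto
  ultimately show ?thesis using on by simp
qed

text \<open>The bound on orthonormal systems allows one of maximal length to be chosen. A function
  with a nonzero remainder in its expansion would extend it by that remainder, normalised. Members
  of the eigenspace are arbitrary outside the group, so the expansion is asserted only on
  \<open>carrier G\<close>.\<close>

lemma eigenspace_finite_dim:
  assumes l: "l > 0"
  obtains n :: nat and e where "\<And>i. i < n \<Longrightarrow> e i \<in> eigenspace l"
    "\<And>h. h \<in> eigenspace l \<Longrightarrow> \<exists>c. \<forall>x\<in>carrier G. h x = (\<Sum>i<n. c i * e i x)"
proof -
  define ON where "ON n e \<longleftrightarrow> (\<forall>i<n. e i \<in> eigenspace l) \<and>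
    (\<forall>i<n. \<forall>j<n. ip (e i) (e j) = (if i = j then 1 else 0))" for n :: nat and e
  define n where "n = (GREATEST n. \<exists>e. ON n e)"
  have bound: "k \<le> nat \<lceil>d 1 / l\<^sup>2\<rceil>" if "\<exists>e. ON k e" for k
    using that eigenspace_orthonormal_bound[OF l, of k] unfolding ON_def
    by (metis of_nat_le_iff order_trans real_nat_ceiling_ge)
  have "\<exists>e. ON 0 e" by (simp add: ON_def)
  then have "\<exists>e. ON n e"
    unfolding n_def using bound by (rule GreatestI_nat)
  then obtain e where e: "ON n e" by blast
  have max: "k \<le> n" if "\<exists>e. ON k e" for k
    unfolding n_def using that bound by (rule Greatest_le_nat)
  have eE: "e i \<in> eigenspace l" if "i < n" for i using e that by (simp add: ON_def)
  have ce: "cont (e i)" if "i < n" for i using eE[OF that] by (simp add: eigenspace_def)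
  have on: "ip (e i) (e j) = (if i = j then 1 else 0)" if "i < n" "j < n" for i j
    using e that by (simp add: ON_def)
  have "h x = (\<Sum>i<n. ip h (e i) * e i x)" if h: "h \<in> eigenspace l" and x: "x \<in> carrier G" for h x
  proof (rule ccontr)
    assume neq: "h x \<noteq> (\<Sum>i<n. ip h (e i) * e i x)"
    have ch: "cont h" using h by (simp add: eigenspace_def)
    define r where "r = (\<lambda>x. h x - (\<Sum>i<n. ip h (e i) * e i x))"
    have r: "r \<in> eigenspace l"
      unfolding r_def using h eE by (intro eigenspace_diff eigenspace_sum eigenspace_cmult)
    then have cr: "cont r" by (simp add: eigenspace_def)
    have rpos: "ip r r > 0" using ip_pos[OF cr x] neq by (simp add: r_def)
    define q where "q = 1 / sqrt (ip r r)"
    have orth: "ip r (e j) = 0" if "j < n" for j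
      unfolding r_def using that by (intro ip_Bessel(1)[OF ch ce on])
    define e' where "e' = e(n := (\<lambda>x. q * r x))"
    have cq: "cont (\<lambda>x. q * r x)" using cr by (rule continuous_map_real_mult_left)
    have "ip (\<lambda>x. q * r x) (\<lambda>x. q * r x) = q * (q * ip r r)"
      using ip_cmult[OF cr cq, of q] ip_cmult[OF cr cr, of q] ip_sym[of r "\<lambda>x. q * r x"] by simp
    also have "\<dots> = 1" using rpos by (simp add: q_def)
    finally have 1: "ip (\<lambda>x. q * r x) (\<lambda>x. q * r x) = 1" .
    have 2: "ip (\<lambda>x. q * r x) (e j) = 0" if "j < n" for j
      using ip_cmult[OF cr ce[OF that], of q] orth[OF that] by simp
    have "ON (Suc n) e'"
      unfolding ON_def
    proof (intro conjI allI impI)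
      fix i assume "i < Suc n"
      then show "e' i \<in> eigenspace l"
        using eE eigenspace_cmult[OF r] by (cases "i = n") (auto simp: e'_def)
    next
      fix i j assume "i < Suc n" "j < Suc n"
      then consider "i < n" "j < n" | "i = n" "j < n" | "i < n" "j = n" | "i = n" "j = n" by linarith
      then show "ip (e' i) (e' j) = (if i = j then 1 else 0)"
      proof cases
        case 3
        then show ?thesis using 2[of i] by (simp add: e'_def ip_sym[of "e i"])
      qed (use on 1 2 in \<open>auto simp: e'_def\<close>)
    qed
    then show False using max[of "Suc n"] by auto
  qed
  then have "\<exists>c. \<forall>x\<in>carrier G. h x = (\<Sum>i<n. c i * e i x)" if "h \<in> eigenspace l" for h
    using that by (intro exI[of _ "\<lambda>i. ip h (e i)"]) simp
  with eE show thesis by (rule that)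
qed

end

context compact_topological_group
begin

text \<open>The kernel is the autocorrelation of \<open>f\<close>, so the associated operator annihilates every
  translation-invariant space that is orthogonal to \<open>f\<close>, but not its own eigenspace.\<close>
lemma Peter_Weyl:
  fixes f :: "'g \<Rightarrow> real"
  assumes f: "cont f" and x0: "x0 \<in> carrier G" "f x0 \<noteq> 0"
  obtains E and n :: nat and e h where "\<And>h. h \<in> E \<Longrightarrow> cont h"
    "\<And>h k. h \<in> E \<Longrightarrow> k \<in> carrier G \<Longrightarrow> ltrans k h \<in> E"
    "\<And>i. i < n \<Longrightarrow> e i \<in> E"
    "\<And>h. h \<in> E \<Longrightarrow> \<exists>c. \<forall>x\<in>carrier G. h x = (\<Sum>i<n. c i * e i x)"
    "h \<in> E" "ip f h \<noteq> 0"
proof -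
  define \<phi> where "\<phi> x = mean (\<lambda>z. f z * f (z \<otimes> x))" for x
  have cF: "continuous_map (prod_topology T T) euclidean (\<lambda>(z, x). f z * f (z \<otimes> x))"
    unfolding case_prod_unfold
    by (intro continuous_map_real_mult continuous_comp[OF f] continuous_mult' continuous_map_fst continuous_map_snd)
  have c\<phi>: "cont \<phi>"
    unfolding \<phi>_def by (rule continuous_map_mean_parameter[OF compact cF])
  have \<phi>_inv: "\<phi> (inv x) = \<phi> x" if x: "x \<in> carrier G" for x
  proof -
    have "\<phi> (inv x) = mean (\<lambda>z. f (z \<otimes> x) * f (z \<otimes> x \<otimes> inv x))"
      unfolding \<phi>_def
      using mean_right[of "\<lambda>z. f z * f (z \<otimes> inv x)" x] f x by (simp add: continuous_map_real_mult cont_right)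
    also have "\<dots> = \<phi> x"
      unfolding \<phi>_def using x by (intro mean_cong) (simp add: m_assoc)
    finally show ?thesis .
  qed
  interpret symmetric_kernel G T \<phi>
    by unfold_locales (use c\<phi> \<phi>_inv in auto)
  have "\<phi> \<one> = ip f f"
    unfolding \<phi>_def ip_def by (intro mean_cong) simp
  then have "\<phi> \<one> \<noteq> 0" using ip_pos[OF f x0] by simp
  then obtain l u where l: "l > 0" and u: "cont u" "\<And>x. x \<in> carrier G \<Longrightarrow> K (K u) x = l * u x"
    "\<exists>x\<in>carrier G. u x \<noteq> 0"
    using eigenfunction[OF one_closed] by blast
  have uE: "u \<in> eigenspace l" using u by (simp add: eigenspace_def)
  have "\<exists>h\<in>eigenspace l. ip f h \<noteq> 0"
  proof (rule ccontr)
    assume "\<not> ?thesis"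
    then have orth: "ip f h = 0" if "h \<in> eigenspace l" for h using that by blast
    \<comment> \<open>Substituting \<open>inv w \<otimes> y\<close> for \<open>y\<close> yields the
      inner product of \<open>f\<close> with a translate of \<open>u\<close>, which lies in the
      eigenspace.\<close>
    have inner: "mean (\<lambda>y. f (w \<otimes> y) * u y) = 0" if w: "w \<in> carrier G" for w
    proof -
      have "mean (\<lambda>y. f (w \<otimes> y) * u y) = mean (\<lambda>y. f (w \<otimes> (inv w \<otimes> y)) * u (inv w \<otimes> y))"
        using mean_left[of "\<lambda>y. f (w \<otimes> y) * u y" "inv w"] f u(1) w
        by (simp add: continuous_map_real_mult cont_left)
      also have "\<dots> = ip f (ltrans w u)"
        unfolding ip_def ltrans_def using w by (intro mean_cong) (simp flip: m_assoc)
      finally show ?thesis using orth eigenspace_ltrans[OF uE w] by simp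
    qed
    \<comment> \<open>Inserting the definition of \<open>\<phi>\<close> and exchanging the means
      exhibits \<open>K u x\<close> as the mean over z of \<open>f z\<close> times the quantity
      \<open>inner\<close> at \<open>z \<otimes> inv x\<close>.\<close>
    have "K u x = 0" if x: "x \<in> carrier G" for x
    proof -
      have cF: "continuous_map (prod_topology T T) euclidean (\<lambda>(y, z). f z * (f (z \<otimes> (inv x \<otimes> y)) * u y))"
        unfolding case_prod_unfold using x
        by (intro continuous_map_real_mult continuous_comp[OF f] continuous_comp[OF u(1)] continuous_mult'
            continuous_const continuous_map_fst continuous_map_snd) auto
      have "K u x = mean (\<lambda>y. mean (\<lambda>z. f z * (f (z \<otimes> (inv x \<otimes> y)) * u y)))"
        unfolding K_def \<phi>_def
      proof (rule mean_cong)
        fix y assume y: "y \<in> carrier G"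
        have "cont (\<lambda>z. f z * f (z \<otimes> (inv x \<otimes> y)))"
          using f x y by (intro continuous_map_real_mult cont_right) auto
        from mean_cmult[OF this, of "u y"]
        show "mean (\<lambda>z. f z * f (z \<otimes> (inv x \<otimes> y))) * u y = mean (\<lambda>z. f z * (f (z \<otimes> (inv x \<otimes> y)) * u y))"
          by (simp add: mult_ac)
      qed
      also have "\<dots> = mean (\<lambda>z. mean (\<lambda>y. f z * (f (z \<otimes> (inv x \<otimes> y)) * u y)))"
        by (rule mean_swap[OF cF])
      also have "\<dots> = mean (\<lambda>z. 0)"
      proof (rule mean_cong)
        fix z assume z: "z \<in> carrier G"
        have "cont (\<lambda>y. f (z \<otimes> inv x \<otimes> y) * u y)"
          using f u(1) x z by (intro continuous_map_real_mult cont_left) auto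
        from mean_cmult[OF this, of "f z"]
        have "mean (\<lambda>y. f z * (f (z \<otimes> inv x \<otimes> y) * u y)) = 0"
          using inner[of "z \<otimes> inv x"] x z by simp
        moreover have "mean (\<lambda>y. f z * (f (z \<otimes> (inv x \<otimes> y)) * u y)) = mean (\<lambda>y. f z * (f (z \<otimes> inv x \<otimes> y) * u y))"
          using x z by (intro mean_cong) (simp add: m_assoc)
        ultimately show "mean (\<lambda>y. f z * (f (z \<otimes> (inv x \<otimes> y)) * u y)) = 0" by simp
      qed
      finally show ?thesis by simp
    qed
    then have "K (K u) = K (\<lambda>_. 0)" by (rule K_cong)
    then have "l * u x = 0" if "x \<in> carrier G" for x
      using u(2)[OF that] by (simp add: K_def)
    then show False using l u(3) by simp
  qed
  then obtain h where h: "h \<in> eigenspace l" "ip f h \<noteq> 0" by blast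
  obtain n :: nat and e where "\<And>i. i < n \<Longrightarrow> e i \<in> eigenspace l"
    "\<And>h. h \<in> eigenspace l \<Longrightarrow> \<exists>c. \<forall>x\<in>carrier G. h x = (\<Sum>i<n. c i * e i x)"
    using eigenspace_finite_dim[OF l] by blast
  moreover have "cont h" if "h \<in> eigenspace l" for h
    using that by (simp add: eigenspace_def)
  ultimately show thesis
    using that[of "eigenspace l" n e h] h eigenspace_ltrans by blast
qed

end

section \<open>Isometric representations\<close>

lemma projection_onto_fixes: "is_projection_onto V P \<Longrightarrow> v \<in> V \<Longrightarrow> P v = v"
  by (simp add: is_projection_onto_def)

lemma projection_onto_in: "is_projection_onto V P \<Longrightarrow> P x \<in> V"
  by (auto simp: is_projection_onto_def)

lemma projection_onto_bounded_linear: "is_projection_onto V P \<Longrightarrow> bounded_linear P"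
  by (simp add: is_projection_onto_def)

lemma closed_projection_range:
  assumes "is_projection_onto V P"
  shows "closed V"
proof -
  have "V = {x. P x = x}"
    using projection_onto_fixes[OF assms] projection_onto_in[OF assms] by (auto, metis)
  moreover have "closed {x. P x = x}"
    using projection_onto_bounded_linear[OF assms]
    by (intro closed_Collect_eq) (auto intro: linear_continuous_on)
  ultimately show ?thesis by simp
qed

locale isometric_representation = compact_topological_group G T
  for G :: "('g, 'z) monoid_scheme" (structure) and T :: "'g topology" +
  fixes \<alpha> :: "'g \<Rightarrow> 'w::banach \<Rightarrow> 'w"
  assumes rep: "strongly_cont_isometric_rep G T \<alpha>"
begin

lemma rep_bounded_linear: "g \<in> carrier G \<Longrightarrow> bounded_linear (\<alpha> g)"
  using rep by (simp add: strongly_cont_isometric_rep_def)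

lemma rep_linear: "g \<in> carrier G \<Longrightarrow> linear (\<alpha> g)"
  using rep_bounded_linear bounded_linear.linear by blast

lemma rep_norm: "g \<in> carrier G \<Longrightarrow> norm (\<alpha> g w) = norm w"
  using rep by (simp add: strongly_cont_isometric_rep_def)

lemma rep_one: "\<alpha> \<one> w = w"
  using rep by (simp add: strongly_cont_isometric_rep_def)

lemma rep_mult: "g \<in> carrier G \<Longrightarrow> h \<in> carrier G \<Longrightarrow> \<alpha> (g \<otimes> h) w = \<alpha> g (\<alpha> h w)"
  using rep by (simp add: strongly_cont_isometric_rep_def)

lemma rep_inv_cancel: "g \<in> carrier G \<Longrightarrow> \<alpha> (inv g) (\<alpha> g w) = w"
  using rep_mult[of "inv g" g w] by (simp add: rep_one)

lemma rep_cancel_inv: "g \<in> carrier G \<Longrightarrow> \<alpha> g (\<alpha> (inv g) w) = w"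
  using rep_mult[of g "inv g" w] by (simp add: rep_one)

lemma cont_orbit: "cont (\<lambda>g. \<alpha> g w)"
  using rep by (simp add: strongly_cont_isometric_rep_def)

text \<open>The argument may vary together with the group element because, \<open>\<alpha> h\<close>
  being isometric, replacing \<open>v h\<close> by \<open>v g\<close> costs only their
  distance.\<close>

lemma cont_rep:
  assumes "cont v"
  shows "cont (\<lambda>g. \<alpha> g (v g))"
  unfolding continuous_map_euclidean_dist
proof (intro ballI allI impI)
  fix g and e :: real assume g: "g \<in> topspace T" and "e > 0"
  then have e: "e / 2 > 0" by simp
  obtain U where U: "openin T U" "g \<in> U" "\<And>h. h \<in> U \<Longrightarrow> dist (v h) (v g) < e / 2"
    using assms[unfolded continuous_map_euclidean_dist, rule_format, OF g e] by blast
  obtain U' where U': "openin T U'" "g \<in> U'" "\<And>h. h \<in> U' \<Longrightarrow> dist (\<alpha> h (v g)) (\<alpha> g (v g)) < e / 2"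
    using cont_orbit[of "v g", unfolded continuous_map_euclidean_dist, rule_format, OF g e] by blast
  have "dist (\<alpha> h (v h)) (\<alpha> g (v g)) < e" if h: "h \<in> U \<inter> U'" for h
  proof -
    have "h \<in> carrier G" using U(1) h openin_subset topspace_eq by blast
    then have "dist (\<alpha> h (v h)) (\<alpha> h (v g)) = dist (v h) (v g)"
      using rep_norm linear_diff[OF rep_linear] by (metis dist_norm)
    then show ?thesis
      using U(3)[of h] U'(3)[of h] h dist_triangle[of "\<alpha> h (v h)" "\<alpha> g (v g)" "\<alpha> h (v g)"] by simp
  qed
  then show "\<exists>V. openin T V \<and> g \<in> V \<and> (\<forall>h\<in>V. dist (\<alpha> h (v h)) (\<alpha> g (v g)) < e)"
    using U U' by (intro exI[of _ "U \<inter> U'"]) auto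
qed

lemma rep_invariant_map_iff:
  "rep_invariant_map G \<alpha> P \<longleftrightarrow> (\<forall>g\<in>carrier G. \<forall>w. P (\<alpha> g w) = \<alpha> g (P w))"
proof
  assume P: "rep_invariant_map G \<alpha> P"
  show "\<forall>g\<in>carrier G. \<forall>w. P (\<alpha> g w) = \<alpha> g (P w)"
  proof (intro ballI allI)
    fix g w assume g: "g \<in> carrier G"
    then have "\<alpha> g (P (\<alpha> (inv g) (\<alpha> g w))) = P (\<alpha> g w)"
      using P unfolding rep_invariant_map_def by (metis comp_apply)
    then show "P (\<alpha> g w) = \<alpha> g (P w)"
      by (simp add: rep_inv_cancel g)
  qed
next
  assume "\<forall>g\<in>carrier G. \<forall>w. P (\<alpha> g w) = \<alpha> g (P w)"
  then show "rep_invariant_map G \<alpha> P"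
    unfolding rep_invariant_map_def by (auto simp: fun_eq_iff rep_cancel_inv)
qed

lemma rep_invariant_mapD:
  "rep_invariant_map G \<alpha> P \<Longrightarrow> g \<in> carrier G \<Longrightarrow> P (\<alpha> g w) = \<alpha> g (P w)"
  by (simp add: rep_invariant_map_iff)

lemma rep_invariant_mem: "rep_invariant G \<alpha> U \<Longrightarrow> g \<in> carrier G \<Longrightarrow> u \<in> U \<Longrightarrow> \<alpha> g u \<in> U"
  by (auto simp: rep_invariant_def)

lemma invariant_projection:
  assumes V: "subspace V" "rep_invariant G \<alpha> V" and Q: "is_projection_onto V Q"
  obtains P where "is_projection_onto V P" "rep_invariant_map G \<alpha> P" "onorm P \<le> onorm Q"
proof -
  have bQ: "bounded_linear Q" using projection_onto_bounded_linear[OF Q] .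
  define k where "k w = (\<lambda>g. \<alpha> g (Q (\<alpha> (inv g) w)))" for w
  define P where "P w = mean (k w)" for w
  have c: "cont (k w)" for w
    unfolding k_def using mean_bounded_linear(1)[OF cont_inv[OF cont_orbit] bQ] by (rule cont_rep)
  have add: "P (x + y) = P x + P y" for x y
  proof -
    have "P (x + y) = mean (\<lambda>g. k x g + k y g)"
      unfolding P_def using bQ
      by (intro mean_cong) (simp add: k_def linear_add[OF rep_linear] linear_add[OF bounded_linear.linear])
    then show ?thesis by (simp add: P_def mean_add c)
  qed
  have scale: "P (r *\<^sub>R x) = r *\<^sub>R P x" for r x
  proof -
    have "P (r *\<^sub>R x) = mean (\<lambda>g. r *\<^sub>R k x g)"
      unfolding P_def using bQ
      by (intro mean_cong) (simp add: k_def linear_scale[OF rep_linear] linear_scale[OF bounded_linear.linear])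
    then show ?thesis by (simp add: P_def mean_scaleR c)
  qed
  have bound: "norm (P w) \<le> onorm Q * norm w" for w
    unfolding P_def
  proof (rule norm_mean_le[OF c])
    fix g assume g: "g \<in> carrier G"
    then have "norm (k w g) = norm (Q (\<alpha> (inv g) w))"
      by (simp add: k_def rep_norm)
    also have "\<dots> \<le> onorm Q * norm (\<alpha> (inv g) w)"
      by (rule onorm[OF bQ])
    finally show "norm (k w g) \<le> onorm Q * norm w"
      using g by (simp add: rep_norm)
  qed
  have bP: "bounded_linear P"
    using add scale bound by (intro bounded_linear_intro[of P "onorm Q"]) (auto simp: mult.commute)
  have "is_projection_onto V P"
  proof (rule is_projection_ontoI[OF bP])
    fix w
    show "P w \<in> V"
      unfolding P_def using projection_onto_in[OF Q] V(2)
      by (intro mean_in_closed_subspace[OF c V(1) closed_projection_range[OF Q]])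
         (auto simp: k_def intro: rep_invariant_mem)
  next
    fix v assume v: "v \<in> V"
    have "P v = mean (\<lambda>_. v)"
      unfolding P_def k_def using v V(2)
      by (intro mean_cong) (simp add: projection_onto_fixes[OF Q] rep_invariant_mem rep_cancel_inv)
    then show "P v = v" by simp
  qed
  moreover have "rep_invariant_map G \<alpha> P"
    unfolding rep_invariant_map_iff
  proof (intro ballI allI)
    fix h w assume h: "h \<in> carrier G"
    \<comment> \<open>Substituting \<open>h \<otimes> g\<close> for \<open>g\<close> cancels
      \<open>h\<close> inside \<open>Q\<close> and leaves \<open>\<alpha> h\<close> outside, so
      invariance of \<open>P\<close> is left invariance of the mean.\<close>
    have "P (\<alpha> h w) = mean (\<lambda>g. k (\<alpha> h w) (h \<otimes> g))"
      unfolding P_def by (rule mean_left[OF c h, symmetric])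
    also have "\<dots> = mean (\<lambda>g. \<alpha> h (k w g))"
      using h by (intro mean_cong) (simp add: k_def inv_mult_group rep_mult rep_inv_cancel)
    also have "\<dots> = \<alpha> h (P w)"
      unfolding P_def by (rule mean_bounded_linear(2)[OF c rep_bounded_linear[OF h]])
    finally show "P (\<alpha> h w) = \<alpha> h (P w)" .
  qed
  moreover have "onorm P \<le> onorm Q"
    using onorm_bound[OF onorm_pos_le[OF bQ]] bound by blast
  ultimately show thesis using that by blast
qed

text \<open>The averaged projection \<open>R\<close> satisfies \<open>Q (R x) = R x\<close>, so
  \<open>S\<close> composed with \<open>R\<close> factors through \<open>S\<close> composed with
  \<open>Q\<close>, which is bounded.\<close>

lemma finite_dim_invariant_projection:
  assumes "fin_inv_subspace G \<alpha> U"
  obtains R where "is_projection_onto U R" "rep_invariant_map G \<alpha> R"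
    "\<And>S::'w \<Rightarrow> 'w. linear S \<Longrightarrow> bounded_linear (\<lambda>x. S (R x))"
proof -
  obtain B where B: "finite B" "span B = U" and U: "subspace U" "rep_invariant G \<alpha> U"
    using assms by (auto simp: fin_inv_subspace_def)
  obtain Q where Q: "is_projection_onto U Q" and SQ: "\<And>S::'w \<Rightarrow> 'w. linear S \<Longrightarrow> bounded_linear (\<lambda>x. S (Q x))"
    using finite_dim_projection[OF B(1)] B(2) by blast
  obtain R where R: "is_projection_onto U R" "rep_invariant_map G \<alpha> R"
    using invariant_projection[OF U Q] by blast
  have "bounded_linear (\<lambda>x. S (R x))" if "linear S" for S :: "'w \<Rightarrow> 'w"
  proof -
    have "S (Q (R x)) = S (R x)" for x
      using projection_onto_fixes[OF Q projection_onto_in[OF R(1)]] by simp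
    then show ?thesis
      using bounded_linear_compose[OF SQ[OF that] projection_onto_bounded_linear[OF R(1)]] by simp
  qed
  then show thesis using that R by blast
qed

section \<open>Equivalence of subrepresentations and Schur's lemma\<close>

lemma equiv_subrep_sym:
  assumes "fin_inv_subspace G \<alpha> U" "equiv_subrep G \<alpha> U U'"
  shows "equiv_subrep G \<alpha> U' U"
proof -
  obtain S where S: "linear S" "bij_betw S U U'" "\<And>g u. g \<in> carrier G \<Longrightarrow> u \<in> U \<Longrightarrow> S (\<alpha> g u) = \<alpha> g (S u)"
    using assms(2) unfolding equiv_subrep_def by blast
  have U: "span U = U" "rep_invariant G \<alpha> U"
    using assms(1) span_eq_iff unfolding fin_inv_subspace_def by blast+
  \<comment> \<open>The inverse, given only on \<open>U'\<close>, must become a linear map of the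
    whole space; a linear left inverse of \<open>S\<close> on the span of \<open>U\<close> is such
    an extension.\<close>
  obtain R where R: "linear R" "\<And>x. x \<in> U \<Longrightarrow> R (S x) = x"
    using linear_inj_on_left_inverse[OF S(1), of U] U S(2) by (auto simp: bij_betw_def)
  have "bij_betw R U' U"
    by (rule bij_betw_byWitness[of _ S]) (use R(2) S(2) in \<open>auto simp: bij_betw_def\<close>)
  moreover have "R (\<alpha> g u) = \<alpha> g (R u)" if g: "g \<in> carrier G" and u: "u \<in> U'" for g u
  proof -
    obtain x where x: "x \<in> U" "u = S x" using u S(2) by (auto simp: bij_betw_def)
    then show ?thesis
      using S(3)[OF g x(1)] R(2) U(2) g rep_invariant_mem by metis
  qed
  ultimately show ?thesis
    using R(1) unfolding equiv_subrep_def by blast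
qed

lemma equiv_subrep_trans:
  assumes "equiv_subrep G \<alpha> U1 U2" "equiv_subrep G \<alpha> U2 U3"
  shows "equiv_subrep G \<alpha> U1 U3"
proof -
  obtain S where S: "linear S" "bij_betw S U1 U2" "\<And>g u. g \<in> carrier G \<Longrightarrow> u \<in> U1 \<Longrightarrow> S (\<alpha> g u) = \<alpha> g (S u)"
    using assms(1) unfolding equiv_subrep_def by blast
  obtain R where R: "linear R" "bij_betw R U2 U3" "\<And>g u. g \<in> carrier G \<Longrightarrow> u \<in> U2 \<Longrightarrow> R (\<alpha> g u) = \<alpha> g (R u)"
    using assms(2) unfolding equiv_subrep_def by blast
  have "R (S (\<alpha> g u)) = \<alpha> g (R (S u))" if "g \<in> carrier G" "u \<in> U1" for g u
    using that S R bij_betwE[OF S(2)] by simp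
  then show ?thesis
    unfolding equiv_subrep_def
    by (intro exI[of _ "R \<circ> S"]) (use S R in \<open>auto intro: linear_compose bij_betw_trans\<close>)
qed

lemma equiv_subrep_refl: "equiv_subrep G \<alpha> U U"
  unfolding equiv_subrep_def by (intro exI[of _ id]) (auto simp: linear_id)

lemma subspace_kernel_on:
  assumes "linear S" "subspace U"
  shows "subspace {u \<in> U. S u = 0}"
  using assms by (auto simp: subspace_def linear_0 linear_add linear_scale)

lemma rep_zero: "g \<in> carrier G \<Longrightarrow> \<alpha> g 0 = 0"
  by (rule linear_0[OF rep_linear])

lemma irred_equiv:
  assumes U: "irred_subspace G \<alpha> U" and U': "fin_inv_subspace G \<alpha> U'" and "equiv_subrep G \<alpha> U' U"
  shows "irred_subspace G \<alpha> U'"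
proof -
  obtain S where S: "linear S" "bij_betw S U' U" "\<And>g u. g \<in> carrier G \<Longrightarrow> u \<in> U' \<Longrightarrow> S (\<alpha> g u) = \<alpha> g (S u)"
    using assms(3) unfolding equiv_subrep_def by blast
  have inj: "inj_on S U'" and im: "S ` U' = U" using S(2) by (auto simp: bij_betw_def)
  have s0: "0 \<in> U'" using U' by (simp add: fin_inv_subspace_def subspace_0)
  have "U' \<noteq> {0}"
    using U im linear_0[OF S(1)] by (auto simp: irred_subspace_def)
  moreover have "K = {0} \<or> K = U'" if K: "subspace K" "K \<subseteq> U'" "rep_invariant G \<alpha> K" for K
  proof -
    have "subspace (S ` K)" using S(1) K(1) by (rule linear_subspace_image)
    moreover have "S ` K \<subseteq> U" using K(2) im by blast
    moreover have "rep_invariant G \<alpha> (S ` K)"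
      unfolding rep_invariant_def
    proof (intro ballI subsetI)
      fix g x assume g: "g \<in> carrier G" and "x \<in> \<alpha> g ` S ` K"
      then obtain u where u: "u \<in> K" "x = \<alpha> g (S u)" by blast
      then have "x = S (\<alpha> g u)" using S(3)[OF g] K(2) by auto
      then show "x \<in> S ` K" using K(3) g u rep_invariant_mem by blast
    qed
    ultimately have "S ` K = {0} \<or> S ` K = U"
      using U unfolding irred_subspace_def by blast
    then show ?thesis
    proof
      assume "S ` K = {0}"
      then have "u = 0" if "u \<in> K" for u
        using that inj K(2) s0 linear_0[OF S(1)] by (metis image_eqI inj_onD singletonD subsetD)
      then show ?thesis using K(1) subspace_0 by blast
    next
      assume "S ` K = U"
      then show ?thesis using inj K(2) im by (metis inj_on_image_eq_iff order_refl)
    qed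
  qed
  ultimately show ?thesis
    using U' by (simp add: irred_subspace_def)
qed

text \<open>Schur's lemma: the kernel of \<open>D\<close> on \<open>U\<close> is an invariant
  subspace, proper because of \<open>u\<close>, hence zero.\<close>

lemma irred_image:
  assumes U: "irred_subspace G \<alpha> U" and D: "linear D" "rep_invariant_map G \<alpha> D"
    and nz: "u \<in> U" "D u \<noteq> 0"
  shows "fin_inv_subspace G \<alpha> (D ` U)" "equiv_subrep G \<alpha> U (D ` U)"
proof -
  have fU: "subspace U" "rep_invariant G \<alpha> U" and B: "\<exists>B. finite B \<and> span B = U"
    using U by (auto simp: irred_subspace_def fin_inv_subspace_def)
  have "rep_invariant G \<alpha> {u \<in> U. D u = 0}"
    unfolding rep_invariant_def
    using fU(2) by (auto simp: rep_invariant_mapD[OF D(2)] rep_zero intro: rep_invariant_mem)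
  then have "{u \<in> U. D u = 0} = {0} \<or> {u \<in> U. D u = 0} = U"
    using U subspace_kernel_on[OF D(1) fU(1)] unfolding irred_subspace_def by blast
  then have K: "{u \<in> U. D u = 0} = {0}" using nz by blast
  have "inj_on D U"
  proof (rule inj_onI)
    fix x y assume "x \<in> U" "y \<in> U" "D x = D y"
    then have "x - y \<in> {u \<in> U. D u = 0}"
      using fU(1) D(1) by (simp add: subspace_diff linear_diff)
    then show "x = y" using K by simp
  qed
  then show "equiv_subrep G \<alpha> U (D ` U)"
    unfolding equiv_subrep_def using D by (intro exI[of _ D]) (auto simp: bij_betw_def rep_invariant_mapD)
  have "\<exists>B. finite B \<and> span B = D ` U"
    using B linear_span_image[OF D(1)] by (metis finite_imageI)
  moreover have "rep_invariant G \<alpha> (D ` U)"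
    unfolding rep_invariant_def
  proof (intro ballI subsetI)
    fix g x assume g: "g \<in> carrier G" and "x \<in> \<alpha> g ` D ` U"
    then obtain u where u: "u \<in> U" "x = \<alpha> g (D u)" by blast
    then have "x = D (\<alpha> g u)" by (simp add: rep_invariant_mapD[OF D(2) g])
    then show "x \<in> D ` U" using fU(2) g u rep_invariant_mem by blast
  qed
  ultimately show "fin_inv_subspace G \<alpha> (D ` U)"
    using linear_subspace_image[OF D(1) fU(1)] by (simp add: fin_inv_subspace_def)
qed

end

section \<open>Invariant projections\<close>

text \<open>Makes the size of a spanning set usable as an induction measure. A basis of the proper
  subspace stays independent when a vector of \<open>span B\<close> outside it is added.\<close>

lemma subspace_smaller_basis:
  assumes B: "finite B" and U: "subspace U" "U \<subset> span B"
  obtains B' where "finite B'" "card B' < card B" "span B' = U"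
proof -
  obtain B' where B': "B' \<subseteq> U" "independent B'" "U \<subseteq> span B'"
    using maximal_independent_subset[of U] by blast
  have sp: "span B' = U"
    using B'(1,3) U(1) by (simp add: span_minimal subset_antisym)
  obtain x where x: "x \<in> span B" "x \<notin> U" using U(2) by blast
  have "independent (insert x B')"
    using B'(2) x(2) sp by (simp add: independent_insertI)
  moreover have "insert x B' \<subseteq> span B" using x(1) B'(1) U(2) by blast
  ultimately have fin: "finite (insert x B')" "card (insert x B') \<le> card B"
    using independent_span_bound[OF B, of "insert x B'"] by simp_all
  have "x \<notin> B'" using x(2) B'(1) by blast
  then show thesis using that[of B'] fin sp by simp
qed

context isometric_representation
begin

section \<open>Invariant subspaces on which a bounded operator does not vanish\<close>

lemma cont_scaleR_orbit:
  assumes "cont h"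
  shows "cont (\<lambda>g. h g *\<^sub>R \<alpha> g w)"
  using assms cont_orbit[of w] by (simp add: continuous_map_atin tendsto_scaleR)

text \<open>Integrating the orbit of \<open>w\<close> against a function gives a map
  \<open>\<omega>\<close> that turns left translation into \<open>\<alpha>\<close>. It sends the
  space from Peter--Weyl onto vectors of a finite-dimensional invariant subspace, and
  \<open>q (D (\<omega> h))\<close> is the nonzero inner product \<open>ip f h\<close>.\<close>

lemma finite_dim_detects:
  assumes D: "bounded_linear D" and w: "D w \<noteq> (0::'w)"
  obtains U u where "fin_inv_subspace G \<alpha> U" "u \<in> U" "D u \<noteq> 0"
proof -
  obtain q :: "'w \<Rightarrow> real" where q: "bounded_linear q" "q (D w) \<noteq> 0"
    using bounded_functional_nonzero[OF w] by metis
  have qD: "bounded_linear (\<lambda>x. q (D x))"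
    by (rule bounded_linear_compose[OF q(1) D])
  define f where "f g = q (D (\<alpha> g w))" for g
  have cf: "cont f"
    unfolding f_def by (rule mean_bounded_linear(1)[OF cont_orbit qD])
  have f1: "f \<one> \<noteq> 0" using q(2) by (simp add: f_def rep_one)
  show thesis
  proof (rule Peter_Weyl[OF cf one_closed f1])
    fix E and n :: nat and e h
    assume E: "\<And>h. h \<in> E \<Longrightarrow> cont h"
      "\<And>h k. h \<in> E \<Longrightarrow> k \<in> carrier G \<Longrightarrow> ltrans k h \<in> E"
      "\<And>i. i < n \<Longrightarrow> e i \<in> E"
      "\<And>h. h \<in> E \<Longrightarrow> \<exists>c. \<forall>x\<in>carrier G. h x = (\<Sum>i<n. c i * e i x)"
      and h: "h \<in> E" "ip f h \<noteq> 0"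
    define \<omega> where "\<omega> h = mean (\<lambda>g. h g *\<^sub>R \<alpha> g w)" for h
    define U where "U = span ((\<lambda>i. \<omega> (e i)) ` {..<n})"
    have \<omega>_U: "\<omega> h \<in> U" if hE: "h \<in> E" for h
    proof -
      obtain c where c: "\<And>x. x \<in> carrier G \<Longrightarrow> h x = (\<Sum>i<n. c i * e i x)"
        using E(4)[OF hE] by blast
      have ce: "cont (\<lambda>g. e i g *\<^sub>R \<alpha> g w)" if "i < n" for i
        by (rule cont_scaleR_orbit[OF E(1)[OF E(3)[OF that]]])
      have "\<omega> h = mean (\<lambda>g. \<Sum>i<n. c i *\<^sub>R (e i g *\<^sub>R \<alpha> g w))"
        unfolding \<omega>_def by (intro mean_cong) (simp add: c scaleR_sum_left)
      also have "\<dots> = (\<Sum>i<n. mean (\<lambda>g. c i *\<^sub>R (e i g *\<^sub>R \<alpha> g w)))"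
        by (intro mean_sum finite_lessThan mean_bounded_linear(1)[OF _ bounded_linear_scaleR_right] ce) simp
      also have "\<dots> = (\<Sum>i<n. c i *\<^sub>R \<omega> (e i))"
        unfolding \<omega>_def using ce by (intro sum.cong refl mean_scaleR) auto
      finally show ?thesis
        unfolding U_def by (simp only:) (intro span_sum span_scale span_base imageI)
    qed
    have \<omega>_rep: "\<alpha> k (\<omega> h) = \<omega> (ltrans k h)" if hE: "h \<in> E" and k: "k \<in> carrier G" for h k
    proof -
      have "\<alpha> k (\<omega> h) = mean (\<lambda>g. \<alpha> k (h g *\<^sub>R \<alpha> g w))"
        unfolding \<omega>_def by (rule mean_bounded_linear(2)[OF cont_scaleR_orbit[OF E(1)[OF hE]] rep_bounded_linear[OF k], symmetric])
      also have "\<dots> = mean (\<lambda>g. ltrans k h (k \<otimes> g) *\<^sub>R \<alpha> (k \<otimes> g) w)"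
        using k by (intro mean_cong) (simp add: ltrans_def linear_scale[OF rep_linear] rep_mult flip: m_assoc)
      also have "\<dots> = \<omega> (ltrans k h)"
        unfolding \<omega>_def by (rule mean_left[OF cont_scaleR_orbit[OF cont_ltrans[OF E(1)[OF hE] k]] k])
      finally show ?thesis .
    qed
    have "rep_invariant G \<alpha> U"
      unfolding rep_invariant_def
    proof
      fix k assume k: "k \<in> carrier G"
      have "\<alpha> k ` U = span (\<alpha> k ` (\<lambda>i. \<omega> (e i)) ` {..<n})"
        unfolding U_def by (rule linear_span_image[OF rep_linear[OF k], symmetric])
      also have "\<dots> \<subseteq> U"
      proof (rule span_minimal)
        show "subspace U" by (simp add: U_def)
        show "\<alpha> k ` (\<lambda>i. \<omega> (e i)) ` {..<n} \<subseteq> U"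
          using \<omega>_rep[OF E(3) k] \<omega>_U E(2,3) k by auto
      qed
      finally show "\<alpha> k ` U \<subseteq> U" .
    qed
    moreover have "subspace U" "\<exists>B. finite B \<and> span B = U"
      unfolding U_def by (blast intro: finite_imageI subspace_span)+
    ultimately have "fin_inv_subspace G \<alpha> U"
      by (simp add: fin_inv_subspace_def)
    moreover have "q (D (\<omega> h)) = ip f h"
    proof -
      have "q (D (\<omega> h)) = mean (\<lambda>g. q (D (h g *\<^sub>R \<alpha> g w)))"
        unfolding \<omega>_def by (rule mean_bounded_linear(2)[OF cont_scaleR_orbit[OF E(1)[OF h(1)]] qD, symmetric])
      also have "\<dots> = ip f h"
        unfolding ip_def by (intro mean_cong)
          (simp add: f_def linear_scale[OF bounded_linear.linear[OF qD]] mult.commute)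
      finally show ?thesis .
    qed
    then have "D (\<omega> h) \<noteq> 0"
      using h(2) linear_0[OF bounded_linear.linear[OF q(1)]] by auto
    ultimately show thesis
      using that \<omega>_U[OF h(1)] by blast
  qed
qed

lemma fin_inv_subspaceI:
  assumes "finite B" "span B = U" "rep_invariant G \<alpha> U"
  shows "fin_inv_subspace G \<alpha> U"
  using assms unfolding fin_inv_subspace_def by (metis subspace_span)

text \<open>Complete reducibility in the form needed. If \<open>D\<close> vanishes on a proper
  invariant subspace \<open>S\<close>, the kernel in \<open>U\<close> of an invariant projection
  \<open>R\<close> onto \<open>S\<close> is a smaller invariant subspace, and it contains
  \<open>u - R u\<close>, where \<open>D\<close> takes the same value as at
  \<open>u\<close>.\<close>

lemma irreducible_detects_of_finite_dim:
  assumes "finite B" "span B = U" "rep_invariant G \<alpha> U" and D: "linear D" and "u \<in> U" "D u \<noteq> (0::'w)"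
  shows "\<exists>U' u'. irred_subspace G \<alpha> U' \<and> u' \<in> U' \<and> D u' \<noteq> 0"
  using assms(1-3,5,6)
proof (induction "card B" arbitrary: B U u rule: less_induct)
  case less
  have fU: "fin_inv_subspace G \<alpha> U" using less.prems(1-3) by (rule fin_inv_subspaceI)
  then have sU: "subspace U" by (simp add: fin_inv_subspace_def)
  have step: ?case if S: "subspace S" "S \<subset> U" "rep_invariant G \<alpha> S" "s \<in> S" "D s \<noteq> 0" for S s
  proof -
    obtain B' where "finite B'" "card B' < card B" "span B' = S"
      using subspace_smaller_basis[OF less.prems(1) S(1)] S(2) less.prems(2) by blast
    then show ?thesis using less.hyps S(3-5) by blast
  qed
  show ?case
  proof (cases "irred_subspace G \<alpha> U")
    case True
    then show ?thesis using less.prems by blast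
  next
    case False
    have "U \<noteq> {0}" using less.prems(4,5) linear_0[OF D] by auto
    then obtain S where S: "subspace S" "S \<subset> U" "rep_invariant G \<alpha> S" "S \<noteq> {0}"
      using False fU unfolding irred_subspace_def by blast
    show ?thesis
    proof (cases "\<exists>s\<in>S. D s \<noteq> 0")
      case True
      then show ?thesis using step[OF S(1-3)] by blast
    next
      case D0: False
      obtain B' where B': "finite B'" "span B' = S"
        using subspace_smaller_basis[OF less.prems(1) S(1)] S(2) less.prems(2) by blast
      obtain R where R: "is_projection_onto S R" "rep_invariant_map G \<alpha> R"
        using finite_dim_invariant_projection[OF fin_inv_subspaceI[OF B' S(3)]] by blast
      have lR: "linear R" using projection_onto_bounded_linear[OF R(1)] bounded_linear.linear by blast
      let ?S = "{x \<in> U. R x = 0}"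
      have "subspace ?S" by (rule subspace_kernel_on[OF lR sU])
      moreover have "?S \<subset> U"
      proof -
        obtain s where "s \<in> S" "s \<noteq> 0" using S(1,4) subspace_0 by blast
        then have "s \<in> U" "R s \<noteq> 0" using S(2) projection_onto_fixes[OF R(1)] by auto
        then show ?thesis by blast
      qed
      moreover have "rep_invariant G \<alpha> ?S"
        unfolding rep_invariant_def using less.prems(3)
        by (auto simp: rep_invariant_mapD[OF R(2)] rep_zero intro: rep_invariant_mem)
      moreover have "u - R u \<in> ?S"
      proof -
        have "R u \<in> S" by (rule projection_onto_in[OF R(1)])
        then show ?thesis
          using S(2) less.prems(4) sU projection_onto_fixes[OF R(1)] by (auto simp: subspace_diff linear_diff[OF lR])
      qed
      moreover have "D (u - R u) \<noteq> 0"
        using D0 projection_onto_in[OF R(1), of u] less.prems(5) by (simp add: linear_diff[OF D])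
      ultimately show ?thesis by (rule step)
    qed
  qed
qed

lemma irreducible_detects:
  assumes D: "bounded_linear D" and w: "D w \<noteq> (0::'w)"
  obtains U u where "irred_subspace G \<alpha> U" "u \<in> U" "D u \<noteq> 0"
proof -
  obtain U u where U: "fin_inv_subspace G \<alpha> U" "u \<in> U" "D u \<noteq> 0"
    using finite_dim_detects[OF assms] by blast
  obtain B where B: "finite B" "span B = U" "rep_invariant G \<alpha> U"
    using U(1) by (auto simp: fin_inv_subspace_def)
  show thesis
    using irreducible_detects_of_finite_dim[OF B bounded_linear.linear[OF D] U(2,3)] that by blast
qed

section \<open>Isotypic components and uniqueness of invariant projections\<close>

lemma isotypic_component_superset:
  assumes "fin_inv_subspace G \<alpha> U'" "equiv_subrep G \<alpha> U' U"
  shows "U' \<subseteq> isotypic_component G \<alpha> U"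
proof
  fix x assume "x \<in> U'"
  then have "x \<in> span (\<Union>{U'. fin_inv_subspace G \<alpha> U' \<and> equiv_subrep G \<alpha> U' U})"
    using assms by (intro span_base) blast
  then show "x \<in> isotypic_component G \<alpha> U"
    unfolding isotypic_component_def using closure_subset by blast
qed

lemma isotypic_component_minimal:
  assumes "subspace S" "closed S"
    and "\<And>U'. fin_inv_subspace G \<alpha> U' \<Longrightarrow> equiv_subrep G \<alpha> U' U \<Longrightarrow> U' \<subseteq> S"
  shows "isotypic_component G \<alpha> U \<subseteq> S"
  unfolding isotypic_component_def
  using assms by (intro closure_minimal span_minimal) auto

lemma isotypic_component_zero: "0 \<in> isotypic_component G \<alpha> U"
  unfolding isotypic_component_def using closure_subset span_zero by blast

lemma rep_invariant_map_diff:
  assumes "rep_invariant_map G \<alpha> P" "rep_invariant_map G \<alpha> Q"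
  shows "rep_invariant_map G \<alpha> (\<lambda>x. P x - Q x)"
  using assms unfolding rep_invariant_map_iff by (simp add: linear_diff[OF rep_linear])

lemma invariant_projection_unique_of_full:
  assumes full: "alpha_full G \<alpha> V"
    and P: "is_projection_onto V P" "rep_invariant_map G \<alpha> P"
    and Q: "is_projection_onto V Q" "rep_invariant_map G \<alpha> Q"
    and V: "subspace V"
  shows "P = Q"
proof (rule ccontr)
  assume "P \<noteq> Q"
  then obtain w where w: "P w - Q w \<noteq> 0" by (auto simp: fun_eq_iff)
  have D: "bounded_linear (\<lambda>x. P x - Q x)"
    using P(1) Q(1) by (intro bounded_linear_sub projection_onto_bounded_linear)
  obtain U u where U: "irred_subspace G \<alpha> U" "u \<in> U" "P u - Q u \<noteq> 0"
    using irreducible_detects[OF D w] by blast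
  note im = irred_image[OF U(1) bounded_linear.linear[OF D] rep_invariant_map_diff[OF P(2) Q(2)] U(2,3)]
  have fU: "fin_inv_subspace G \<alpha> U" using U(1) by (simp add: irred_subspace_def)
  \<comment> \<open>The image of \<open>U\<close> under the difference is itself a copy of
    \<open>U\<close>, so it lies in the same component; it also lies in \<open>V\<close>, which
    makes fullness applicable.\<close>
  have "P u - Q u \<in> isotypic_component G \<alpha> U"
    using isotypic_component_superset[OF im(1) equiv_subrep_sym[OF fU im(2)]] U(2) by blast
  moreover have "P u - Q u \<in> V"
    using V projection_onto_in[OF P(1)] projection_onto_in[OF Q(1)] by (simp add: subspace_diff)
  ultimately have "V \<inter> isotypic_component G \<alpha> U \<noteq> {0}" using U(3) by blast
  then have "isotypic_component G \<alpha> U \<subseteq> V"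
    using full U(1) unfolding alpha_full_def by blast
  then have "u \<in> V"
    using isotypic_component_superset[OF fU equiv_subrep_refl] U(2) by blast
  then show False
    using U(3) projection_onto_fixes[OF P(1)] projection_onto_fixes[OF Q(1)] by simp
qed

lemma invariant_projection_not_unique_of_not_full:
  assumes V: "subspace V" "closed V"
    and P: "is_projection_onto V P" "rep_invariant_map G \<alpha> P" and nf: "\<not> alpha_full G \<alpha> V"
  obtains Q where "is_projection_onto V Q" "rep_invariant_map G \<alpha> Q" "Q \<noteq> P"
proof -
  obtain U where U: "irred_subspace G \<alpha> U" "V \<inter> isotypic_component G \<alpha> U \<noteq> {0}"
    "V \<inter> isotypic_component G \<alpha> U \<noteq> isotypic_component G \<alpha> U"
    using nf unfolding alpha_full_def by blast
  have bP: "bounded_linear P" by (rule projection_onto_bounded_linear[OF P(1)])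
  have lP: "linear P" by (rule bounded_linear.linear[OF bP])
  define D where "D x = x - P x" for x
  have bD: "bounded_linear D"
    unfolding D_def by (intro bounded_linear_sub bounded_linear_ident bP)
  have lD: "linear D" by (rule bounded_linear.linear[OF bD])
  have invD: "rep_invariant_map G \<alpha> D"
    unfolding D_def using P(2) by (intro rep_invariant_map_diff) (simp add: rep_invariant_map_iff)
  have PD: "P (D x) = 0" for x
    using projection_onto_fixes[OF P(1) projection_onto_in[OF P(1)]] by (simp add: D_def linear_diff[OF lP])
  have DV: "D v = 0" if "v \<in> V" for v
    using projection_onto_fixes[OF P(1) that] by (simp add: D_def)
  \<comment> \<open>If \<open>P\<close> vanished on all copies of \<open>U\<close>, it would vanish
    on their closed linear span; but it fixes the nonzero part of that component lying in
    \<open>V\<close>.\<close>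
  obtain U1 x where U1: "fin_inv_subspace G \<alpha> U1" "equiv_subrep G \<alpha> U1 U" "x \<in> U1" "P x \<noteq> 0"
  proof (rule ccontr)
    assume no: "\<not> thesis"
    have "isotypic_component G \<alpha> U \<subseteq> {x. P x = 0}"
    proof (rule isotypic_component_minimal)
      show "subspace {x. P x = 0}" using subspace_kernel_on[OF lP subspace_UNIV] by simp
      show "closed {x. P x = 0}"
        using bP by (intro closed_Collect_eq) (auto intro: linear_continuous_on)
      show "U' \<subseteq> {x. P x = 0}" if "fin_inv_subspace G \<alpha> U'" "equiv_subrep G \<alpha> U' U" for U'
        using no that \<open>\<And>x U1. fin_inv_subspace G \<alpha> U1 \<Longrightarrow> equiv_subrep G \<alpha> U1 U \<Longrightarrow> x \<in> U1 \<Longrightarrow> P x \<noteq> 0 \<Longrightarrow> thesis\<close>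
        by blast
    qed
    then have "v = 0" if "v \<in> V \<inter> isotypic_component G \<alpha> U" for v
      using that projection_onto_fixes[OF P(1), of v] by auto
    then have "V \<inter> isotypic_component G \<alpha> U = {0}"
      using isotypic_component_zero subspace_0[OF V(1)] by blast
    with U(2) show False by blast
  qed
  \<comment> \<open>A closed subspace \<open>V\<close> containing all copies of \<open>U\<close>
    would contain the whole component.\<close>
  obtain U2 y where U2: "fin_inv_subspace G \<alpha> U2" "equiv_subrep G \<alpha> U2 U" "y \<in> U2" "y \<notin> V"
    using isotypic_component_minimal[OF V, of U] U(3) by blast
  have Dy: "D y \<noteq> 0" using U2(4) projection_onto_in[OF P(1), of y] by (auto simp: D_def)
  note im1 = irred_image[OF irred_equiv[OF U(1) U1(1,2)] lP P(2) U1(3,4)]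
  note im2 = irred_image[OF irred_equiv[OF U(1) U2(1,2)] lD invD U2(3) Dy]
  have "equiv_subrep G \<alpha> (D ` U2) (P ` U1)"
    using equiv_subrep_sym[OF U2(1) im2(2)] U2(2) equiv_subrep_sym[OF U1(1,2)] im1(2)
    by (meson equiv_subrep_trans)
  then obtain S where S: "linear S" "bij_betw S (D ` U2) (P ` U1)"
    "\<And>g u. g \<in> carrier G \<Longrightarrow> u \<in> D ` U2 \<Longrightarrow> S (\<alpha> g u) = \<alpha> g (S u)"
    unfolding equiv_subrep_def by blast
  obtain R where R: "is_projection_onto (D ` U2) R" "rep_invariant_map G \<alpha> R"
    and SR: "bounded_linear (\<lambda>x. S (R x))"
    using finite_dim_invariant_projection[OF im2(1)] S(1) by metis
  \<comment> \<open>The added term vanishes on \<open>V\<close> because \<open>D\<close> does, and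
    has values in \<open>V\<close> because \<open>S\<close> maps into the image of \<open>P\<close>;
    so \<open>Q\<close> is again a projection onto \<open>V\<close>. At \<open>D y\<close> the map
    \<open>P\<close> vanishes, while \<open>Q\<close> yields \<open>S (D y)\<close>, which is
    nonzero by injectivity of \<open>S\<close>.\<close>
  define Q where "Q x = P x + S (R (D x))" for x
  have lR: "linear R" using projection_onto_bounded_linear[OF R(1)] bounded_linear.linear by blast
  have "is_projection_onto V Q"
  proof (rule is_projection_ontoI)
    show "bounded_linear Q"
      unfolding Q_def by (intro bounded_linear_add bP bounded_linear_compose[OF SR bD])
    fix x
    have "S (R (D x)) \<in> P ` U1"
      using bij_betwE[OF S(2)] projection_onto_in[OF R(1)] by blast
    then have "S (R (D x)) \<in> V" using projection_onto_in[OF P(1)] by auto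
    then show "Q x \<in> V"
      unfolding Q_def using V(1) projection_onto_in[OF P(1)] by (simp add: subspace_add)
  next
    fix v assume v: "v \<in> V"
    then show "Q v = v"
      using projection_onto_fixes[OF P(1) v] DV[OF v] by (simp add: Q_def linear_0[OF lR] linear_0[OF S(1)])
  qed
  moreover have "rep_invariant_map G \<alpha> Q"
    unfolding rep_invariant_map_iff
  proof (intro ballI allI)
    fix g w assume g: "g \<in> carrier G"
    have "S (R (D (\<alpha> g w))) = \<alpha> g (S (R (D w)))"
      using S(3)[OF g projection_onto_in[OF R(1)]]
      by (simp add: rep_invariant_mapD[OF invD g] rep_invariant_mapD[OF R(2) g])
    then show "Q (\<alpha> g w) = \<alpha> g (Q w)"
      by (simp add: Q_def rep_invariant_mapD[OF P(2) g] linear_add[OF rep_linear[OF g]])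
  qed
  moreover have "Q \<noteq> P"
  proof
    assume "Q = P"
    then have "S (R (D (D y))) = 0" using PD[of y] by (metis Q_def add_0)
    moreover have "D (D y) = D y" using PD[of y] by (simp add: D_def)
    moreover have "R (D y) = D y" using projection_onto_fixes[OF R(1)] U2(3) by blast
    ultimately have "S (D y) = S 0" by (simp add: linear_0[OF S(1)])
    moreover have "0 \<in> D ` U2" using im2(1) subspace_0 unfolding fin_inv_subspace_def by blast
    ultimately show False
      using S(2) U2(3) Dy unfolding bij_betw_def inj_on_def by blast
  qed
  ultimately show thesis using that by blast
qed

end

theorem theorem6p3:
  fixes G :: "('g, 'z) monoid_scheme" and T :: "'g topology"
    and \<alpha> :: "'g \<Rightarrow> 'w::banach \<Rightarrow> 'w" and V :: "'w set"
  assumes "compact_group G T"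
    and "strongly_cont_isometric_rep G T \<alpha>"
    and "subspace V" and "closed V" and "rep_invariant G \<alpha> V"
    and "\<exists>P. is_projection_onto V P"
  shows "(\<exists>P. is_projection_onto V P \<and> rep_invariant_map G \<alpha> P) \<and>
         ((\<exists>!P. is_projection_onto V P \<and> rep_invariant_map G \<alpha> P) \<longleftrightarrow> alpha_full G \<alpha> V) \<and>
         (alpha_full G \<alpha> V \<longrightarrow>
           (\<forall>P. is_projection_onto V P \<and> rep_invariant_map G \<alpha> P \<longrightarrow>
             (\<forall>Q. is_projection_onto V Q \<longrightarrow> onorm P \<le> onorm Q)))"
proof -
  interpret isometric_representation G T \<alpha>
    using assms(1,2)
    by (simp add: compact_group_def isometric_representation_def isometric_representation_axioms_def
        compact_topological_group_def compact_topological_group_axioms_def)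
  let ?inv = "\<lambda>P. is_projection_onto V P \<and> rep_invariant_map G \<alpha> P"
  have avg: "\<exists>P. ?inv P \<and> onorm P \<le> onorm Q" if "is_projection_onto V Q" for Q
    using invariant_projection[OF assms(3,5) that] by blast
  then have ex: "\<exists>P. ?inv P" using assms(6) by blast
  have unique: "P = Q" if "alpha_full G \<alpha> V" "?inv P" "?inv Q" for P Q
    using that invariant_projection_unique_of_full assms(3) by blast
  have "alpha_full G \<alpha> V" if "\<exists>!P. ?inv P"
    using that invariant_projection_not_unique_of_not_full[OF assms(3,4)] by metis
  moreover have "\<exists>!P. ?inv P" if "alpha_full G \<alpha> V"
    using ex unique[OF that] by blast
  moreover have "onorm P \<le> onorm Q" if "alpha_full G \<alpha> V" "?inv P" "is_projection_onto V Q" for P Q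
    using avg[OF that(3)] unique[OF that(1,2)] by blast
  ultimately show ?thesis using ex by blast
qed

end
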